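(* Let $0<r<\frac1e$ and let $B:=B(0,r)\subset\mathbb{R}^2$ be the open ball of radius $r$ centered at the origin. For every compact subset $K\subset B$ there exists a weak solution $u=(u_1,u_2)\in W^{1,2}(B,\mathbb{R}^2)\cap L^\infty(B,\mathbb{R}^2)$ of the nonlinear elliptic system $\Delta u=F(u,\nabla u)$ in $B$, where $$F(u,\nabla u)=\left(-2|\nabla u|^2\,\frac{u_1+u_2}{1+|u|^2},\; 2|\nabla u|^2\,\frac{u_1-u_2}{1+|u|^2}\right),$$ such that $u$ is singular on $K$ (i.e. discontinuous at every point of $K$) and smooth elsewhere (i.e. $C^\infty$ on $B\setminus K$).
   Context: Here $|\nabla u|^2=|\nabla u_1|^2+|\nabla u_2|^2$ and $|u|^2=u_1^2+u_2^2$. Weak solution of $\Delta u=F(u,\nabla u)$ in $B$ means: for $j=1,2$ and every $\phi\in C_0^\infty(B)$ (smooth, compactly supported, real-valued), $-\int_B\nabla u_j\cdot\nabla\phi\,dx=\int_B F_j(u,\nabla u)\,\phi\,dx$. Since $u$ is an element of a Sobolev space, discontinuous at $x_0$ means that no function equal to $u$ almost everywhere is continuous at $x_0$; $C^\infty$ on $B\setminus K$ means that $u$ agrees almost everywhere on $B\setminus K$ with a $C^\infty$ map. *)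

theory Defs
  imports "HOL-Analysis.Analysis"
begin

text \<open>
  \<open>Ck_on k S f\<close> is the usual notion of a \<open>C\<^sup>k\<close> map on an \<^emph>\<open>open\<close> set \<open>S\<close>: on a finite-dimensional
  domain, continuity of all directional derivatives is continuity of the derivative.
\<close>

primrec Ck_on ::
    "nat \<Rightarrow> 'a::euclidean_space set \<Rightarrow> ('a \<Rightarrow> 'b::real_normed_vector) \<Rightarrow> bool" where
  "Ck_on 0 S f \<longleftrightarrow> continuous_on S f"
| "Ck_on (Suc k) S f \<longleftrightarrow>
     (\<forall>x\<in>S. f differentiable (at x)) \<and>
     (\<forall>v. Ck_on k S (\<lambda>x. frechet_derivative f (at x) v))"

definition smooth_on :: "'a::euclidean_space set \<Rightarrow> ('a \<Rightarrow> 'b::real_normed_vector) \<Rightarrow> bool" where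
  "smooth_on S f \<longleftrightarrow> (\<forall>k. Ck_on k S f)"

text \<open>
  \<open>C\<^sub>0\<^sup>\<infinity>(\<Omega>)\<close>, each test function being extended by zero to the whole space.
\<close>

definition test_functions :: "'a::euclidean_space set \<Rightarrow> ('a \<Rightarrow> real) set" where
  "test_functions \<Omega> =
     {\<phi>. smooth_on UNIV \<phi> \<and> compact (closure {x. \<phi> x \<noteq> 0}) \<and> closure {x. \<phi> x \<noteq> 0} \<subseteq> \<Omega>}"

definition gradient :: "(real^'n \<Rightarrow> real) \<Rightarrow> real^'n \<Rightarrow> real^'n" where
  "gradient \<phi> x = (\<chi> i. frechet_derivative \<phi> (at x) (axis i 1))"

definition locally_integrable_on ::
    "('a::euclidean_space \<Rightarrow> 'b::euclidean_space) \<Rightarrow> 'a set \<Rightarrow> bool" where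
  "locally_integrable_on f \<Omega> \<longleftrightarrow> (\<forall>C. compact C \<and> C \<subseteq> \<Omega> \<longrightarrow> f absolutely_integrable_on C)"

definition has_weak_gradient ::
    "(real^'n) set \<Rightarrow> (real^'n \<Rightarrow> real) \<Rightarrow> (real^'n \<Rightarrow> real^'n) \<Rightarrow> bool" where
  "has_weak_gradient \<Omega> f g \<longleftrightarrow>
     locally_integrable_on f \<Omega> \<and> locally_integrable_on g \<Omega> \<and>
     (\<forall>\<phi>\<in>test_functions \<Omega>. \<forall>i.
        (LINT x|lebesgue_on \<Omega>. f x * gradient \<phi> x $ i) = - (LINT x|lebesgue_on \<Omega>. g x $ i * \<phi> x))"

text \<open>Row \<open>j\<close> of \<open>Du x\<close> is the gradient of the \<open>j\<close>-th component of \<open>u\<close>.\<close>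

definition has_weak_jacobian ::
    "(real^'n) set \<Rightarrow> (real^'n \<Rightarrow> real^'m) \<Rightarrow> (real^'n \<Rightarrow> real^'n^'m) \<Rightarrow> bool" where
  "has_weak_jacobian \<Omega> u Du \<longleftrightarrow> (\<forall>j. has_weak_gradient \<Omega> (\<lambda>x. u x $ j) (\<lambda>x. Du x $ j))"

definition L2 :: "'a::euclidean_space set \<Rightarrow> ('a \<Rightarrow> 'b::euclidean_space) set" where
  "L2 \<Omega> = {f. f \<in> borel_measurable (lebesgue_on \<Omega>) \<and>
              integrable (lebesgue_on \<Omega>) (\<lambda>x. (norm (f x))\<^sup>2)}"

definition Linfty :: "'a::euclidean_space set \<Rightarrow> ('a \<Rightarrow> 'b::euclidean_space) set" where
  "Linfty \<Omega> = {f. f \<in> borel_measurable (lebesgue_on \<Omega>) \<and>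
                  (\<exists>C. AE x in lebesgue_on \<Omega>. norm (f x) \<le> C)}"

definition W12 :: "(real^'n) set \<Rightarrow> (real^'n \<Rightarrow> real^'m) set" where
  "W12 \<Omega> = {u. u \<in> L2 \<Omega> \<and> (\<exists>Du. has_weak_jacobian \<Omega> u Du \<and> Du \<in> L2 \<Omega>)}"

text \<open>
  Weak solutions of \<open>\<Delta>u = F(u, \<nabla>u)\<close>. The weak Jacobian is unique almost everywhere, so the choice
  of \<open>Du\<close> is immaterial. Integrability of the right-hand side is required explicitly because the
  Bochner integral of a non-integrable function is 0.
\<close>

definition weak_solution ::
    "(real^'n) set \<Rightarrow> (real^'m \<Rightarrow> real^'n^'m \<Rightarrow> real^'m) \<Rightarrow> (real^'n \<Rightarrow> real^'m) \<Rightarrow> bool" where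
  "weak_solution \<Omega> F u \<longleftrightarrow>
     (\<exists>Du. has_weak_jacobian \<Omega> u Du \<and>
       (\<forall>j. \<forall>\<phi>\<in>test_functions \<Omega>.
          integrable (lebesgue_on \<Omega>) (\<lambda>x. F (u x) (Du x) $ j * \<phi> x) \<and>
          - (LINT x|lebesgue_on \<Omega>. (Du x $ j) \<bullet> gradient \<phi> x)
            = (LINT x|lebesgue_on \<Omega>. F (u x) (Du x) $ j * \<phi> x)))"

definition essentially_discontinuous_at ::
    "'a::euclidean_space set \<Rightarrow> ('a \<Rightarrow> 'b::euclidean_space) \<Rightarrow> 'a \<Rightarrow> bool" where
  "essentially_discontinuous_at \<Omega> u x\<^sub>0 \<longleftrightarrow>
     (\<forall>v. (AE x in lebesgue_on \<Omega>. v x = u x) \<longrightarrow> \<not> continuous (at x\<^sub>0 within \<Omega>) v)"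

definition essentially_smooth_on ::
    "'a::euclidean_space set \<Rightarrow> ('a \<Rightarrow> 'b::euclidean_space) \<Rightarrow> bool" where
  "essentially_smooth_on S u \<longleftrightarrow> (\<exists>v. smooth_on S v \<and> (AE x in lebesgue_on S. v x = u x))"

definition F_rhs :: "real^2 \<Rightarrow> real^2^2 \<Rightarrow> real^2" where
  "F_rhs u Du =
     (let q = (norm (Du $ 1))\<^sup>2 + (norm (Du $ 2))\<^sup>2;
          s = 1 + ((u $ 1)\<^sup>2 + (u $ 2)\<^sup>2)
      in vector [- 2 * q * ((u $ 1 + u $ 2) / s), 2 * q * ((u $ 1 - u $ 2) / s)])"

end

theory Submission
  imports Defs "HOL-Complex_Analysis.Cauchy_Integral_Formula"
begin

text \<open>
  For \<open>u = (sin \<theta>, cos \<theta>)\<close> the system reduces to \<open>\<Delta>\<theta> = - |\<nabla>\<theta>|\<^sup>2\<close>, which says that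
  \<open>w = exp \<theta>\<close> is harmonic. Take \<open>w x = (\<Sum>k. c k * ln (1 / |x - z k|))\<close> with \<open>(z k)\<close> dense in \<open>K\<close>;
  since \<open>2 r < 1\<close> all terms are positive. The poles are harmless for the weak equation because
  \<open>\<nabla>\<theta> = \<nabla>w / w\<close> is square integrable and \<open>w = \<infinity>\<close> at each pole: for a finite sum, the smooth
  function \<open>(max 0 (1 - w / M))\<^sup>2\<close> cuts out neighbourhoods of the poles, and \<open>M \<rightarrow> \<infinity>\<close> together with the
  number of poles by dominated convergence. If the \<open>c k\<close> decrease fast enough, then near
  \<open>z k\<close>, outside a set of small relative measure, \<open>w\<close> is \<open>C ln (1 / |x - z k|)\<close> up to a bounded
  error, so \<open>\<theta>\<close> comes close to every phase modulo \<open>2 \<pi>\<close> on sets of positive measure.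
\<close>

subsection \<open>Smooth functions and test functions\<close>

text \<open>When the poles are dense in \<open>K\<close>, the true potential is infinite on a dense
  subset of \<open>K\<close>, so near \<open>K\<close> the equation cannot be verified pointwise.
  What can be controlled is the finite sums, by one integrable majorant common to all
  \<open>N\<close>: \<open>(norm (DW N x) / W N x)\<^sup>2 \<le> \<kappa> * G x\<close> at almost
  every \<open>x\<close>. This is why the cutoff acts on the value of the potential and not on the
  distance to the poles: as a function of the value \<open>s\<close> it has slope at most
  \<open>2 / s\<close> at every level, so the term that it adds to the weak equation obeys the same
  majorant, and the size of the excised sets never has to be estimated. The coefficients meet two
  demands: summable square roots, for \<open>G\<close>, and smallness relative to the distances from
  earlier poles, for the oscillation. Both are upper bounds on each \<open>c j\<close> separately,
  so they can be imposed together without a recursion. The oscillation survives the error terms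
  because \<open>ln\<close> damps them: a bounded error in a large \<open>w\<close> shifts the phase
  \<open>ln w\<close> by little, while the main term can be given any large value by choice of the
  radius.\<close>

lemma Ck_on_cong:
  assumes "open S" and "\<And>x. x \<in> S \<Longrightarrow> f x = g x"
  shows "Ck_on k S f \<longleftrightarrow> Ck_on k S g"
  using assms(2)
proof (induction k arbitrary: f g)
  case 0
  then show ?case by (simp cong: continuous_on_cong)
next
  case (Suc k)
  have D: "(f has_derivative f') (at x) \<longleftrightarrow> (g has_derivative f') (at x)" if "x \<in> S" for x f'
    using has_derivative_transform_within_open[OF _ assms(1) that] Suc.prems by metis
  have "f differentiable (at x) \<longleftrightarrow> g differentiable (at x)" if "x \<in> S" for x
    using D[OF that] by (simp add: differentiable_def)
  moreover have "frechet_derivative f (at x) v = frechet_derivative g (at x) v" if "x \<in> S" for x v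
    using D[OF that] by (simp add: frechet_derivative_def)
  then have "Ck_on k S (\<lambda>x. frechet_derivative f (at x) v) \<longleftrightarrow> Ck_on k S (\<lambda>x. frechet_derivative g (at x) v)" for v
    by (intro Suc.IH) auto
  ultimately show ?case by simp
qed

text \<open>Smoothness is obtained from a class of functions closed under directional derivatives,
  so that no higher derivative is ever computed. Each order of differentiability uses the closure
  property once, with the whole class as induction invariant; equality on the open set
  \<open>S\<close> suffices by \<open>Ck_on_cong\<close>.\<close>

lemma smooth_on_coinduct:
  assumes "open S" and "f \<in> X"
    and step: "\<And>f. f \<in> X \<Longrightarrow> \<exists>D. (\<forall>x\<in>S. (f has_derivative D x) (at x)) \<and>
                 (\<forall>v. \<exists>g\<in>X. \<forall>x\<in>S. D x v = g x)"
  shows "smooth_on S f"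
proof -
  have "Ck_on k S f" if "f \<in> X" for k f
    using that
  proof (induction k arbitrary: f)
    case 0
    from step[OF this] obtain D where "\<forall>x\<in>S. (f has_derivative D x) (at x)" by blast
    then have "isCont f x" if "x \<in> S" for x
      using has_derivative_continuous[of f "D x" x UNIV] that by simp
    then show ?case by (simp add: continuous_at_imp_continuous_on)
  next
    case (Suc k)
    from step[OF Suc.prems] obtain D where D: "\<And>x. x \<in> S \<Longrightarrow> (f has_derivative D x) (at x)"
      and X: "\<And>v. \<exists>g\<in>X. \<forall>x\<in>S. D x v = g x" by blast
    have "Ck_on k S (\<lambda>x. frechet_derivative f (at x) v)" for v
    proof -
      obtain g where g: "g \<in> X" "\<And>x. x \<in> S \<Longrightarrow> D x v = g x" using X by blast
      have "frechet_derivative f (at x) v = g x" if "x \<in> S" for x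
        using frechet_derivative_at[OF D[OF that]] g(2)[OF that] by simp
      then show ?thesis
        using Suc.IH[OF g(1)] Ck_on_cong[OF assms(1), of "\<lambda>x. frechet_derivative f (at x) v" g k] by simp
    qed
    then show ?case using D by (auto simp: differentiable_def)
  qed
  with assms(2) show ?thesis by (simp add: smooth_on_def)
qed

text \<open>By translation invariance all difference quotients of \<open>f\<close> have integral 0.\<close>

lemma integral_directional_derivative_eq_0:
  fixes f g :: "'a::euclidean_space \<Rightarrow> real"
  assumes contf: "continuous_on UNIV f" and contg: "continuous_on UNIV g"
    and S: "compact S" "\<And>x. x \<notin> S \<Longrightarrow> f x = 0"
    and deriv: "\<And>x. ((\<lambda>t. f (x + t *\<^sub>R e)) has_real_derivative g x) (at 0)"
  shows "has_bochner_integral lborel g 0"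
proof -
  have g0: "g x = 0" if "x \<notin> S" for x
  proof -
    have "open (- S)" using compact_imp_closed[OF S(1)] by (simp add: open_Compl)
    moreover have "((\<lambda>t. x + t *\<^sub>R e) \<longlongrightarrow> x + 0 *\<^sub>R e) (at (0::real))"
      by (intro tendsto_intros)
    ultimately have "\<forall>\<^sub>F t in at 0. x + t *\<^sub>R e \<in> - S"
      using that by (intro topological_tendstoD) auto
    then have "\<forall>\<^sub>F t in nhds 0. f (x + t *\<^sub>R e) = 0"
      using S(2) that by (auto simp: eventually_at_filter elim!: eventually_mono)
    then have "((\<lambda>t. 0) has_real_derivative g x) (at 0)"
      using deriv[of x] DERIV_cong_ev[of 0 0 "\<lambda>t. f (x + t *\<^sub>R e)" "\<lambda>t. 0" "g x" "g x"] by simp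
    then show ?thesis using DERIV_unique DERIV_const by blast
  qed
  obtain R where R: "\<And>x. x \<in> S \<Longrightarrow> norm x \<le> R"
    using S(1) compact_imp_bounded bounded_iff by metis
  have "bounded (g ` S)"
    using compact_continuous_image[OF continuous_on_subset[OF contg] S(1)] compact_imp_bounded by blast
  then obtain C0 where C0: "\<And>x. x \<in> S \<Longrightarrow> \<bar>g x\<bar> \<le> C0"
    unfolding bounded_iff by auto
  define C where "C = max C0 0"
  have C: "\<bar>g x\<bar> \<le> C" for x using C0[of x] g0[of x] by (cases "x \<in> S") (simp_all add: C_def le_max_iff_disj)
  have deriv': "((\<lambda>s. f (x + s *\<^sub>R e)) has_real_derivative g (x + t *\<^sub>R e)) (at t)" for x t
  proof -
    have "(\<lambda>s. f (x + t *\<^sub>R e + s *\<^sub>R e)) = (\<lambda>s. f (x + (s + t) *\<^sub>R e))"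
      by (simp add: scaleR_add_left add_ac)
    then show ?thesis
      using deriv[of "x + t *\<^sub>R e"] DERIV_shift[of "\<lambda>s. f (x + s *\<^sub>R e)" "g (x + t *\<^sub>R e)" 0 t] by simp
  qed
  define s where "s = (\<lambda>n::nat. 1 / (1 + real n))"
  have s: "0 < s n" "s n \<le> 1" for n unfolding s_def by auto
  have s0: "s \<longlonglongrightarrow> 0"
    using LIMSEQ_inverse_real_of_nat unfolding s_def inverse_eq_divide of_nat_Suc .
  define q where "q = (\<lambda>n x. (f (x + s n *\<^sub>R e) - f x) / s n)"
  have qlim: "(\<lambda>n. q n x) \<longlonglongrightarrow> g x" for x
  proof -
    have "((\<lambda>h. (f (x + h *\<^sub>R e) - f x) / h) \<longlongrightarrow> g x) (at 0)"
      using deriv[of x] by (simp add: DERIV_def)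
    moreover have "filterlim s (at 0) sequentially"
      using s0 s(1) by (auto simp: filterlim_at intro!: always_eventually less_imp_neq[symmetric])
    ultimately show ?thesis unfolding q_def
      by (rule filterlim_compose)
  qed
  \<comment> \<open>The mean value theorem bounds all quotients by the supremum of the derivative.
    As \<open>s n \<le> 1\<close>, the shift moves the support by at most \<open>norm e\<close>, so
    one enlarged ball serves every \<open>n\<close>.\<close>
  have qbound: "\<bar>q n x\<bar> \<le> C * indicator (cball 0 (R + norm e)) x" for n x
  proof (cases "norm x \<le> R + norm e")
    case True
    have "\<exists>z. 0 < z \<and> z < s n \<and> f (x + s n *\<^sub>R e) - f (x + 0 *\<^sub>R e) = (s n - 0) * g (x + z *\<^sub>R e)"
      by (rule MVT2) (use s deriv' in auto)
    then obtain t where "f (x + s n *\<^sub>R e) - f x = s n * g (x + t *\<^sub>R e)" by auto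
    then have "q n x = g (x + t *\<^sub>R e)" using s(1)[of n] by (simp add: q_def)
    then show ?thesis using C True by simp
  next
    case False
    have "norm x \<le> norm (x + s n *\<^sub>R e) + norm (s n *\<^sub>R e)"
      using norm_triangle_ineq4[of "x + s n *\<^sub>R e" "s n *\<^sub>R e"] by simp
    also have "norm (s n *\<^sub>R e) \<le> norm e" using s[of n] by (simp add: mult_left_le_one_le)
    finally have "norm (x + s n *\<^sub>R e) > R" using False by simp
    then have "x + s n *\<^sub>R e \<notin> S" using R[of "x + s n *\<^sub>R e"] by auto
    moreover have "x \<notin> S" using R[of x] False norm_ge_zero[of e] by linarith
    ultimately have "f (x + s n *\<^sub>R e) = 0" "f x = 0" using S(2) by auto
    then show ?thesis using False by (simp add: q_def)
  qed
  have fint: "integrable lborel f"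
  proof -
    have "f = (\<lambda>x. indicator S x *\<^sub>R f x)" using S(2) by (force simp: indicator_def)
    moreover have "integrable lborel (\<lambda>x. indicator S x *\<^sub>R f x)"
      using borel_integrable_compact[OF S(1) continuous_on_subset[OF contf]] by auto
    ultimately show ?thesis by metis
  qed
  have shift: "(LINT x|lborel. f (x + v)) = (LINT x|lborel. f x)" "integrable lborel (\<lambda>x. f (x + v))" for v
  proof -
    have [measurable]: "f \<in> borel_measurable borel" using contf by (rule borel_measurable_continuous_onI)
    have m: "(\<lambda>x. v + x) \<in> measurable lborel borel" by simp
    show "(LINT x|lborel. f (x + v)) = (LINT x|lborel. f x)"
      using integral_distr[OF m, of f] unfolding lborel_distr_plus by (simp add: add.commute)
    show "integrable lborel (\<lambda>x. f (x + v))"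
      using integrable_distr_eq[OF m, of f] fint unfolding lborel_distr_plus by (simp add: add.commute)
  qed
  have qint: "(LINT x|lborel. q n x) = 0" for n
    unfolding q_def using shift fint by simp
  have [measurable]: "g \<in> borel_measurable borel" "f \<in> borel_measurable borel"
    using contg contf by (auto intro: borel_measurable_continuous_onI)
  have dom: "integrable lborel (\<lambda>x. C * indicator (cball 0 (R + norm e)) x :: real)"
    by (intro integrable_mult_right integrable_real_indicator) (use emeasure_lborel_cball_finite[of 0 "R + norm e"] in \<open>auto simp: top.not_eq_extremum\<close>)
  have qm: "q n \<in> borel_measurable lborel" for n unfolding q_def by measurable
  have "(\<lambda>n. LINT x|lborel. q n x) \<longlonglongrightarrow> (LINT x|lborel. g x)"
    by (rule integral_dominated_convergence[where s = q, OF _ qm dom]) (use qlim qbound in auto)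
  moreover have "integrable lborel g"
    by (rule integrable_dominated_convergence[where s = q, OF _ qm dom]) (use qlim qbound in auto)
  ultimately show ?thesis
    using qint by (simp add: has_bochner_integral_iff LIMSEQ_const_iff)
qed

section \<open>Integration by parts against test functions\<close>

lemma test_function_gradient:
  fixes \<phi> :: "real^'n \<Rightarrow> real"
  assumes "\<phi> \<in> test_functions \<Omega>"
  shows "continuous_on UNIV \<phi>" and "continuous_on UNIV (gradient \<phi>)"
    and "((\<lambda>t. \<phi> (x + t *\<^sub>R axis i 1)) has_real_derivative gradient \<phi> x $ i) (at 0)"
    and "x \<notin> closure {x. \<phi> x \<noteq> 0} \<Longrightarrow> gradient \<phi> x = 0"
proof -
  have 1: "Ck_on (Suc 0) UNIV \<phi>"
    using assms by (auto simp: test_functions_def smooth_on_def simp del: Ck_on.simps)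
  then have D: "(\<phi> has_derivative frechet_derivative \<phi> (at x)) (at x)" for x
    by (simp add: frechet_derivative_works)
  show "continuous_on UNIV \<phi>"
    using has_derivative_continuous[OF D] by (simp add: continuous_on_eq_continuous_at)
  show "continuous_on UNIV (gradient \<phi>)"
    using 1 unfolding gradient_def by (auto intro!: continuous_intros)
  have "((\<lambda>t. \<phi> (x + t *\<^sub>R axis i 1)) has_derivative
      (\<lambda>t. frechet_derivative \<phi> (at x) (t *\<^sub>R axis i 1))) (at 0)" for x
    by (rule has_derivative_compose[of "\<lambda>t. x + t *\<^sub>R axis i 1"])
       (use D[of x] in \<open>auto intro!: derivative_eq_intros\<close>)
  moreover have "frechet_derivative \<phi> (at x) (t *\<^sub>R axis i 1) = gradient \<phi> x $ i * t" for t x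
    using linear_cmul[OF has_derivative_linear[OF D[of x]], of t "axis i 1"] by (simp add: gradient_def)
  ultimately show "((\<lambda>t. \<phi> (x + t *\<^sub>R axis i 1)) has_real_derivative gradient \<phi> x $ i) (at 0)"
    by (simp add: has_field_derivative_def)
  assume x: "x \<notin> closure {x. \<phi> x \<noteq> 0}"
  have "((\<lambda>x. 0) has_derivative frechet_derivative \<phi> (at x)) (at x)"
    by (rule has_derivative_transform_within_open[OF D[of x], of "- closure {x. \<phi> x \<noteq> 0}"])
       (use x closure_subset[of "{x. \<phi> x \<noteq> 0}"] in auto)
  then have "frechet_derivative \<phi> (at x) = (\<lambda>v. 0)"
    using has_derivative_unique has_derivative_const by blast
  then show "gradient \<phi> x = 0" by (simp add: gradient_def vec_eq_iff)
qed

text \<open>A field that vanishes near its finitely many singularities behaves as if it had none: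
  its product with \<phi> extends by zero to a continuous function of compact support on the whole
  plane or space, whose partial derivative has integral 0. The integrand is the product rule for
  that derivative.\<close>

lemma test_function_integral_by_parts:
  fixes \<phi> f f' :: "real^'n \<Rightarrow> real"
  assumes \<phi>: "\<phi> \<in> test_functions \<Omega>" and "open \<Omega>" and P: "finite P"
    and V: "open V" "P \<subseteq> V" "\<And>x. x \<in> V \<inter> \<Omega> - P \<Longrightarrow> f x = 0" "\<And>x. x \<in> V \<inter> \<Omega> - P \<Longrightarrow> f' x = 0"
    and cont: "continuous_on (\<Omega> - P) f" "continuous_on (\<Omega> - P) f'"
    and deriv: "\<And>x. x \<in> \<Omega> - P \<Longrightarrow> ((\<lambda>t. f (x + t *\<^sub>R axis i 1)) has_real_derivative f' x) (at 0)"
  shows "has_bochner_integral (lebesgue_on \<Omega>) (\<lambda>x. gradient \<phi> x $ i * f x + \<phi> x * f' x) 0"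
proof -
  note grad = test_function_gradient[OF \<phi>]
  let ?S = "closure {x. \<phi> x \<noteq> 0}"
  have S: "compact ?S" "?S \<subseteq> \<Omega>" using \<phi> by (auto simp: test_functions_def)
  define ze where "ze = (\<lambda>h x. if x \<in> \<Omega> - P then h x else (0::real))"
  let ?F = "ze (\<lambda>x. \<phi> x * f x)" and ?G = "ze (\<lambda>x. gradient \<phi> x $ i * f x + \<phi> x * f' x)"
  have op: "open (\<Omega> - P)" using \<open>open \<Omega>\<close> P by (simp add: finite_imp_closed open_Diff)
  \<comment> \<open>Two open sets cover the space: on one the extension is given by the formula, on
    the other it is identically 0. Continuity and differentiability are glued from the two.\<close>
  have cover: "x \<in> \<Omega> - P \<or> x \<in> (V \<inter> \<Omega>) \<union> - ?S" for x
    using S V(2) by blast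
  have opW: "open ((V \<inter> \<Omega>) \<union> - ?S)" using V(1) \<open>open \<Omega>\<close> by auto
  have \<phi>0: "gradient \<phi> x $ i = 0" "\<phi> x = 0" if "x \<notin> ?S" for x
    using that grad(4)[OF that] closure_subset[of "{x. \<phi> x \<noteq> 0}"] by auto
  have z: "?F x = 0 \<and> ?G x = 0" if x: "x \<in> (V \<inter> \<Omega>) \<union> - ?S" for x
  proof (cases "x \<in> V \<inter> \<Omega> - P")
    case True
    then show ?thesis using V(3,4)[OF True] by (simp add: ze_def)
  next
    case False
    then have "x \<notin> \<Omega> - P \<or> x \<notin> ?S" using x by blast
    then show ?thesis
    proof
      assume "x \<notin> \<Omega> - P"
      then show ?thesis unfolding ze_def by (simp only: if_False)
    next
      assume "x \<notin> ?S"
      from \<phi>0[OF this] show ?thesis by (simp add: ze_def)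
    qed
  qed
  have ze_cont: "continuous_on UNIV (ze h)"
    if "continuous_on (\<Omega> - P) h" and h0: "\<And>x. x \<in> (V \<inter> \<Omega>) \<union> - ?S \<Longrightarrow> ze h x = 0" for h
  proof -
    have "continuous_on (\<Omega> - P) (ze h)"
      using that(1) by (rule continuous_on_eq) (simp add: ze_def)
    moreover have "continuous_on ((V \<inter> \<Omega>) \<union> - ?S) (ze h)"
      using h0 by (subst continuous_on_cong[OF refl, of _ _ "\<lambda>_. 0"]) auto
    ultimately have "continuous_on ((\<Omega> - P) \<union> ((V \<inter> \<Omega>) \<union> - ?S)) (ze h)"
      using op opW by (rule continuous_on_open_Un[rotated 2])
    moreover have "(\<Omega> - P) \<union> ((V \<inter> \<Omega>) \<union> - ?S) = UNIV" using cover by blast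
    ultimately show ?thesis by simp
  qed
  have c\<phi>: "continuous_on A \<phi>" "continuous_on A (gradient \<phi>)" for A
    using grad(1,2) continuous_on_subset by blast+
  have line: "((\<lambda>t::real. x + t *\<^sub>R axis i 1) \<longlongrightarrow> x) (nhds 0)" for x :: "real^'n"
    using tendsto_eq_intros(1) by (auto intro!: tendsto_eq_intros filterlim_ident)
  have ev: "\<forall>\<^sub>F t::real in nhds 0. x + t *\<^sub>R axis i 1 \<in> A" if "open A" "x \<in> A" for A and x :: "real^'n"
    using topological_tendstoD[OF line that] .
  have "has_bochner_integral lborel ?G 0"
  proof (rule integral_directional_derivative_eq_0[where S = ?S and f = ?F and e = "axis i 1"])
    have "continuous_on (\<Omega> - P) (\<lambda>x. \<phi> x * f x)"
      by (intro continuous_on_mult cont c\<phi>)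
    then show "continuous_on UNIV ?F" by (rule ze_cont) (use z in blast)
    have "continuous_on (\<Omega> - P) (\<lambda>x. gradient \<phi> x $ i * f x + \<phi> x * f' x)"
      by (intro continuous_on_mult continuous_on_add cont c\<phi> continuous_on_component)
    then show "continuous_on UNIV ?G" by (rule ze_cont) (use z in blast)
    show "?F x = 0" if "x \<notin> ?S" for x using z that by blast
    show "((\<lambda>t. ?F (x + t *\<^sub>R axis i 1)) has_real_derivative ?G x) (at 0)" for x
    proof (cases "x \<in> \<Omega> - P")
      case True
      have "((\<lambda>t. \<phi> (x + t *\<^sub>R axis i 1) * f (x + t *\<^sub>R axis i 1)) has_real_derivative ?G x) (at 0)"
        using True by (auto intro!: derivative_eq_intros grad(3) deriv simp: ze_def)
      moreover have "\<forall>\<^sub>F t in nhds 0. ?F (x + t *\<^sub>R axis i 1) = \<phi> (x + t *\<^sub>R axis i 1) * f (x + t *\<^sub>R axis i 1)"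
        using ev[OF op True] by (rule eventually_mono) (simp add: ze_def)
      ultimately show ?thesis
        using DERIV_cong_ev[of 0 0 "\<lambda>t. ?F (x + t *\<^sub>R axis i 1)" _ "?G x" "?G x"] by simp
    next
      case False
      then have W: "x \<in> (V \<inter> \<Omega>) \<union> - ?S" using cover by blast
      have "\<forall>\<^sub>F t in nhds 0. ?F (x + t *\<^sub>R axis i 1) = 0"
        using ev[OF opW W] by (rule eventually_mono) (use z in blast)
      then show ?thesis
        using z[OF W] DERIV_cong_ev[of 0 0 "\<lambda>t. ?F (x + t *\<^sub>R axis i 1)" "\<lambda>t. 0" "?G x" 0] by simp
    qed
  qed (use S in auto)
  then have "has_bochner_integral lebesgue ?G 0"
    using borel_measurable_integrable[of lborel ?G]
    by (auto simp: has_bochner_integral_iff integrable_completion integral_completion)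
  \<comment> \<open>On \<Omega> the extended and the original integrand differ only on
    \<open>P\<close>, a null set.\<close>
  then have "has_bochner_integral lebesgue (\<lambda>x. indicator \<Omega> x *\<^sub>R (gradient \<phi> x $ i * f x + \<phi> x * f' x)) 0"
    by (subst (asm) has_bochner_integral_discrete_difference[of P])
       (use P in \<open>auto simp: ze_def indicator_def countable_finite\<close>)
  then show ?thesis
    using \<open>open \<Omega>\<close> by (simp add: has_bochner_integral_restrict_space)
qed

lemma test_function_bounded:
  assumes "\<phi> \<in> test_functions \<Omega>"
  obtains C where "0 \<le> C" "\<And>x. \<bar>\<phi> x\<bar> \<le> C" "\<And>x. norm (gradient \<phi> x) \<le> C"
proof -
  let ?S = "closure {x. \<phi> x \<noteq> 0}"
  note grad = test_function_gradient[OF assms]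
  have S: "compact ?S" using assms by (simp add: test_functions_def)
  have "bounded (\<phi> ` ?S)" "bounded (gradient \<phi> ` ?S)"
    using grad(1,2) S continuous_on_subset[OF _ subset_UNIV]
    by (metis compact_continuous_image compact_imp_bounded)+
  then obtain A B where A: "\<forall>x\<in>?S. norm (\<phi> x) \<le> A" and B: "\<forall>x\<in>?S. norm (gradient \<phi> x) \<le> B"
    unfolding bounded_iff by blast
  have out: "\<phi> x = 0 \<and> gradient \<phi> x = 0" if "x \<notin> ?S" for x
    using that grad(4)[OF that] closure_subset[of "{x. \<phi> x \<noteq> 0}"] by auto
  show ?thesis
  proof
    show "0 \<le> max 0 (max A B)" by simp
    show "\<bar>\<phi> x\<bar> \<le> max 0 (max A B)" for x
      using A[rule_format, of x] out[of x] by (cases "x \<in> ?S") auto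
    show "norm (gradient \<phi> x) \<le> max 0 (max A B)" for x
      using B[rule_format, of x] out[of x] by (cases "x \<in> ?S") auto
  qed
qed

section \<open>The cutoff as a function of the value of the potential\<close>

lemma DERIV_max_0_power2: "((\<lambda>s::real. (max 0 s)\<^sup>2) has_real_derivative 2 * max 0 s) (at s)"
proof (rule linorder_cases[of s 0])
  assume "s < 0"
  then have "\<forall>\<^sub>F x in nhds s. (max 0 x)\<^sup>2 = 0"
    using eventually_nhds_in_open[of "{..<0}" s] by (auto elim!: eventually_mono)
  from DERIV_cong_ev[OF refl this, of "2 * max 0 s" 0] \<open>s < 0\<close> show ?thesis by simp
next
  assume "0 < s"
  then have "\<forall>\<^sub>F x in nhds s. (max 0 x)\<^sup>2 = x\<^sup>2"
    using eventually_nhds_in_open[of "{0<..}" s] by (auto elim!: eventually_mono)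
  from DERIV_cong_ev[OF refl this, of "2 * max 0 s" "2 * s"] \<open>0 < s\<close> show ?thesis
    by (auto intro!: derivative_eq_intros)
next
  assume s: "s = 0"
  have "((\<lambda>h::real. max 0 h) \<longlongrightarrow> max 0 0) (at 0)" by (intro tendsto_intros)
  moreover have "\<forall>\<^sub>F h in at (0::real). max 0 h = ((max 0 (0 + h))\<^sup>2 - (max 0 0)\<^sup>2) / h"
    by (auto simp: eventually_at_filter power2_eq_square max_def)
  ultimately have "((\<lambda>h. ((max 0 (0 + h))\<^sup>2 - (max 0 0)\<^sup>2) / h) \<longlongrightarrow> max 0 (0::real)) (at 0)"
    by (rule Lim_transform_eventually)
  then show ?thesis by (simp add: DERIV_def s)
qed

text \<open>The parameter \<open>m\<close> is the reciprocal of the level beyond which everything is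
  cut away. The square makes the positive part continuously differentiable at the junction
  \<open>m * s = 1\<close>, as integration by parts requires.\<close>

definition cut :: "real \<Rightarrow> real \<Rightarrow> real" where
  "cut m s = (max 0 (1 - m * s))\<^sup>2"

definition cut' :: "real \<Rightarrow> real \<Rightarrow> real" where
  "cut' m s = - 2 * m * max 0 (1 - m * s)"

lemma DERIV_cut: "(cut m has_real_derivative cut' m s) (at s)"
proof -
  have "((\<lambda>s. 1 - m * s) has_real_derivative - m) (at s)" by (auto intro!: derivative_eq_intros)
  from DERIV_chain2[OF DERIV_max_0_power2 this] show ?thesis
    by (simp add: cut_def[abs_def] cut'_def mult_ac)
qed

lemma continuous_cut [continuous_intros]:
  "continuous_on A f \<Longrightarrow> continuous_on A (\<lambda>x. cut m (f x))"
  "continuous_on A f \<Longrightarrow> continuous_on A (\<lambda>x. cut' m (f x))"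
  unfolding cut_def cut'_def by (intro continuous_intros; assumption)+

text \<open>The slope bound is uniform in \<open>m\<close> because \<open>m < 1 / s\<close> wherever
  the slope is nonzero. This uniformity lets the cutoff be removed by dominated convergence.\<close>

lemma cut_bounds:
  assumes "0 < m" "0 < s"
  shows "0 \<le> cut m s" "cut m s \<le> 1" "\<bar>cut' m s\<bar> \<le> 2 / s"
proof -
  define b where "b = max 0 (1 - m * s)"
  have b: "0 \<le> b" "b \<le> 1" using mult_pos_pos[OF assms] by (auto simp: b_def)
  show "0 \<le> cut m s" by (simp add: cut_def)
  show "cut m s \<le> 1" using b by (simp add: cut_def b_def[symmetric] power_le_one)
  have "m * b \<le> 1 / s"
  proof (cases "m * s < 1")
    case True
    then have "m \<le> 1 / s" using assms by (simp add: field_simps)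
    moreover have "m * b \<le> m * 1" using b assms by (intro mult_left_mono) auto
    ultimately show ?thesis by simp
  qed (use assms in \<open>simp add: b_def\<close>)
  then show "\<bar>cut' m s\<bar> \<le> 2 / s" using assms b by (simp add: cut'_def b_def[symmetric] abs_mult)
qed

lemma cut_eq_0: "1 \<le> m * s \<Longrightarrow> cut m s = 0" "1 \<le> m * s \<Longrightarrow> cut' m s = 0"
  by (simp_all add: cut_def cut'_def)

lemma tendsto_cut:
  assumes "s \<longlonglongrightarrow> l"
  shows "(\<lambda>n. cut (inverse (real (Suc n))) (s n)) \<longlonglongrightarrow> 1"
    "(\<lambda>n. cut' (inverse (real (Suc n))) (s n)) \<longlonglongrightarrow> 0"
proof -
  have "(\<lambda>n. max 0 (1 - inverse (real (Suc n)) * s n)) \<longlonglongrightarrow> max 0 (1 - 0 * l)"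
    by (intro tendsto_intros assms LIMSEQ_inverse_real_of_nat)
  then have *: "(\<lambda>n. max 0 (1 - inverse (real (Suc n)) * s n)) \<longlonglongrightarrow> 1" by simp
  from tendsto_power[OF this, of 2]
  show "(\<lambda>n. cut (inverse (real (Suc n))) (s n)) \<longlonglongrightarrow> 1" unfolding cut_def by simp
  have "(\<lambda>n. - 2 * inverse (real (Suc n)) * max 0 (1 - inverse (real (Suc n)) * s n)) \<longlonglongrightarrow> - 2 * 0 * 1"
    by (intro tendsto_intros * LIMSEQ_inverse_real_of_nat)
  then show "(\<lambda>n. cut' (inverse (real (Suc n))) (s n)) \<longlonglongrightarrow> 0" unfolding cut'_def by simp
qed

lemma borel_measurable_cut [measurable]:
  "cut m \<in> borel_measurable borel" "cut' m \<in> borel_measurable borel"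
  unfolding cut_def[abs_def] cut'_def[abs_def] by measurable

lemma borel_measurable_component:
  "f \<in> borel_measurable M \<Longrightarrow> (\<lambda>x. f x $ i :: real) \<in> borel_measurable M"
  by (rule borel_measurable_continuous_on[of "\<lambda>v. v $ i"]) (auto intro: continuous_intros)

subsection \<open>The logarithmic kernel\<close>

text \<open>Up to constants, the square of the gradient of \<open>ln (ln (1 / t))\<close> with its logarithmic factor
  weakened from exponent 2 to 3/2; the loss is what makes the estimate summable over infinitely many poles.\<close>

definition log_kernel :: "real \<Rightarrow> real" where
  "log_kernel t = 1 / (t\<^sup>2 * (- ln t * sqrt (- ln t)))"

lemma log_kernel_nonneg: "t \<le> 1 \<Longrightarrow> 0 \<le> t \<Longrightarrow> 0 \<le> log_kernel t"
  by (cases "t = 0") (simp_all add: log_kernel_def mult_nonneg_nonpos2 mult_nonneg_nonpos mult_nonpos_nonneg)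

text \<open>With \<open>l = - ln t\<close>, the inequality \<open>ln y \<le> y - 1\<close> at
  \<open>y = 1 / sqrt t\<close> gives \<open>l\<^sup>2 * t \<le> 4\<close>, and
  \<open>l * sqrt l \<le> 1 + l\<^sup>2\<close>; hence the constant 5. The kernel thus dominates
  both the size \<open>1 / t\<close> of the gradient of a logarithm and the logarithm itself, so
  summability of the kernels makes the series for \<open>w\<close> and \<open>Dw\<close>
  converge.\<close>

lemma log_kernel_ge:
  assumes "0 < t" "t < 1"
  shows "1 / t \<le> 5 * log_kernel t" and "- ln t \<le> 5 * log_kernel t"
proof -
  define l where "l = - ln t"
  have l: "0 < l" using assms by (simp add: l_def)
  have "ln (1 / sqrt t) \<le> 1 / sqrt t - 1" using assms by (intro ln_le_minus_one) simp
  then have "l / 2 \<le> 1 / sqrt t"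
    using assms by (simp add: l_def ln_div ln_sqrt)
  then have "(l / 2)\<^sup>2 \<le> (1 / sqrt t)\<^sup>2" using l by (intro power_mono) auto
  then have l2: "l\<^sup>2 * t \<le> 4" using assms by (simp add: power_divide field_simps)
  have "l * sqrt l \<le> 1 + l\<^sup>2"
  proof (cases "l \<le> 1")
    case True
    then have "l * sqrt l \<le> 1 * 1" using l by (intro mult_mono) auto
    then show ?thesis using zero_le_power2[of l] by linarith
  next
    case False
    then have "sqrt l \<le> sqrt (l\<^sup>2)" by (intro real_sqrt_le_mono) (simp add: power2_eq_square)
    then have "l * sqrt l \<le> l * l" using l by simp
    then show ?thesis by (simp add: power2_eq_square)
  qed
  then have "t * (l * sqrt l) \<le> t * (1 + l\<^sup>2)" using assms by simp
  also have "\<dots> \<le> 5" using assms l2 by (simp add: algebra_simps)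
  finally have "t * (l * sqrt l) \<le> 5" .
  then show "1 / t \<le> 5 * log_kernel t"
    using assms l unfolding log_kernel_def l_def[symmetric] by (simp add: field_simps power2_eq_square)
  moreover have "ln (1 / t) \<le> 1 / t - 1" using assms by (intro ln_le_minus_one) simp
  ultimately show "- ln t \<le> 5 * log_kernel t" using assms by (simp add: ln_div)
qed

text \<open>The kernel blows up at 0 and at 1, so it is not monotone; its two factors are estimated
  at opposite ends of the interval.\<close>

lemma log_kernel_antimono_bound:
  assumes "0 < a" "a \<le> t" "t \<le> b" "b < 1"
  shows "log_kernel t \<le> 1 / (a\<^sup>2 * (- ln b * sqrt (- ln b)))"
  unfolding log_kernel_def
proof (rule divide_left_mono)
  have pos: "- ln b \<le> - ln t" "0 < - ln b" using assms by auto
  then have "- ln b * sqrt (- ln b) \<le> - ln t * sqrt (- ln t)" by (intro mult_mono) auto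
  moreover have "a\<^sup>2 \<le> t\<^sup>2" using assms by (intro power_mono) auto
  ultimately show "a\<^sup>2 * (- ln b * sqrt (- ln b)) \<le> t\<^sup>2 * (- ln t * sqrt (- ln t))"
    using pos by (intro mult_mono) (simp_all add: mult_nonpos_nonneg)
  show "0 < t\<^sup>2 * (- ln t * sqrt (- ln t)) * (a\<^sup>2 * (- ln b * sqrt (- ln b)))"
    using assms by (intro mult_pos_pos zero_less_power real_sqrt_gt_zero) auto
qed simp

lemma dyadic_scale:
  fixes t q :: real
  assumes "0 < t" "t < q"
  obtains m where "q / 2 ^ Suc m \<le> t" "t < q / 2 ^ m"
proof -
  obtain n where n: "q / t < 2 ^ n" using real_arch_pow[of 2 "q / t"] by auto
  define k where "k = (LEAST n. q / 2 ^ n \<le> t)"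
  have "q / 2 ^ n \<le> t" using n assms by (simp add: field_simps)
  then have k: "q / 2 ^ k \<le> t" unfolding k_def by (rule LeastI)
  then obtain m where m: "k = Suc m" using assms by (cases k) auto
  have "\<not> q / 2 ^ m \<le> t" using not_less_Least[of m "\<lambda>n. q / 2 ^ n \<le> t"] m by (simp add: k_def)
  with k m that show ?thesis by auto
qed

text \<open>Dyadic decomposition around the centre: at scale \<open>q / 2 ^ m\<close> the area
  cancels the factor \<open>1 / t\<^sup>2\<close> up to a constant and leaves the power -3/2 of a
  logarithm that is at least \<open>m * ln 2\<close>. The resulting series converges because 3/2 >
  1. The bound does not depend on the centre, which is what allows many poles to be summed.\<close>

lemma nn_integral_log_kernel:
  assumes "0 < q" "q < 1"
  obtains I where "0 \<le> I"
    "\<And>c :: real^2. (\<integral>\<^sup>+x. ennreal (log_kernel (dist c x)) * indicator (ball c q) x \<partial>lborel) \<le> ennreal I"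
proof -
  define b where "b = (\<lambda>m::nat. q / 2 ^ m)"
  define l where "l = (\<lambda>m. - ln (b m))"
  define K where "K = (\<lambda>m. 1 / ((b (Suc m))\<^sup>2 * (l m * sqrt (l m))))"
  have b: "0 < b m" "b m < 1" for m
  proof -
    have "q / 2 ^ m \<le> q / 1" using assms by (intro divide_left_mono) auto
    then have "q / 2 ^ m < 1" using assms by linarith
    with assms show "0 < b m" "b m < 1" by (simp_all add: b_def)
  qed
  have l: "0 < l m" "l m \<ge> real m * ln 2" for m
    using b[of m] assms by (simp_all add: l_def) (simp add: b_def ln_div ln_realpow)
  have K: "0 \<le> K m" for m using l[of m] by (simp add: K_def)
  have Kb: "K m * ((b m)\<^sup>2 * pi) = 4 * pi / (l m * sqrt (l m))" for m
    using l(1)[of m] assms by (simp add: K_def b_def power_divide field_simps power2_eq_square)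
  have "summable (\<lambda>m. 4 * pi / (l m * sqrt (l m)))"
  proof (rule summable_comparison_test')
    show "summable (\<lambda>m. 4 * pi / (ln 2 * sqrt (ln 2)) * real m powr (- (3 / 2)))"
      by (intro summable_mult) (simp add: summable_real_powr_iff)
    fix m :: nat assume m: "1 \<le> m"
    have pw: "real m powr (- (3 / 2)) = 1 / (real m * sqrt (real m))"
    proof -
      have "real m powr (3 / 2) = real m powr 1 * real m powr (1 / 2)"
        unfolding powr_add[symmetric] by simp
      then show ?thesis using m by (simp add: powr_minus_divide powr_half_sqrt)
    qed
    have "real m * ln 2 * sqrt (real m * ln 2) \<le> l m * sqrt (l m)"
      using l[of m] by (intro mult_mono) auto
    then have "4 * pi / (l m * sqrt (l m)) \<le> 4 * pi / (real m * ln 2 * sqrt (real m * ln 2))"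
      using m l[of m] by (intro divide_left_mono mult_pos_pos) auto
    then show "norm (4 * pi / (l m * sqrt (l m))) \<le> 4 * pi / (ln 2 * sqrt (ln 2)) * real m powr (- (3 / 2))"
      using l[of m] by (simp add: pw real_sqrt_mult mult_ac)
  qed
  then have sm: "summable (\<lambda>m. K m * ((b m)\<^sup>2 * pi))" by (simp add: Kb)
  show ?thesis
  proof
    show "0 \<le> (\<Sum>m. K m * ((b m)\<^sup>2 * pi))" using sm K by (intro suminf_nonneg) auto
    fix c :: "real^2"
    have "(\<integral>\<^sup>+x. ennreal (log_kernel (dist c x)) * indicator (ball c q) x \<partial>lborel)
      \<le> (\<integral>\<^sup>+x. (\<Sum>m. ennreal (K m) * indicator (ball c (b m)) x) \<partial>lborel)"
    proof (rule nn_integral_mono)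
      fix x :: "real^2"
      show "ennreal (log_kernel (dist c x)) * indicator (ball c q) x \<le> (\<Sum>m. ennreal (K m) * indicator (ball c (b m)) x)"
      proof (cases "x \<in> ball c q \<and> x \<noteq> c")
        case True
        then obtain m where m: "q / 2 ^ Suc m \<le> dist c x" "dist c x < q / 2 ^ m"
          using dyadic_scale[of "dist c x" q] by auto
        then have "log_kernel (dist c x) \<le> K m"
          unfolding K_def l_def b_def using b[of m] b[of "Suc m"] assms
          by (intro log_kernel_antimono_bound) (auto simp: b_def)
        then have "ennreal (log_kernel (dist c x)) * indicator (ball c q) x \<le> ennreal (K m) * indicator (ball c (b m)) x"
          using True m by (simp add: b_def ennreal_leI)
        also have "\<dots> = (\<Sum>m\<in>{m}. ennreal (K m) * indicator (ball c (b m)) x)"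
          by (simp only: sum.insert sum.empty finite.emptyI empty_iff add_0_right not_False_eq_True)
        also have "\<dots> \<le> (\<Sum>m. ennreal (K m) * indicator (ball c (b m)) x)"
          by (intro sum_le_suminf) auto
        finally show ?thesis .
      next
        \<comment> \<open>Outside the disc the indicator is 0, and at the centre the kernel takes
          the default value 1/0 = 0.\<close>
        case False
        then show ?thesis by (auto simp: log_kernel_def)
      qed
    qed
    also have "\<dots> = (\<Sum>m. \<integral>\<^sup>+x. ennreal (K m) * indicator (ball c (b m)) x \<partial>lborel)"
      by (intro nn_integral_suminf borel_measurable_times_ennreal borel_measurable_const borel_measurable_indicator) auto
    also have "\<dots> = (\<Sum>m. ennreal (K m * ((b m)\<^sup>2 * pi)))"
    proof (intro arg_cong[where f = suminf] ext)
      fix m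
      have "emeasure lborel (ball c (b m)) = ennreal ((b m)\<^sup>2 * pi)"
        using b[of m] circle_area[of "b m" c] emeasure_eq_ennreal_measure[of lborel "ball c (b m)"]
          emeasure_lborel_ball_finite[of c "b m"] by simp
      then show "(\<integral>\<^sup>+x. ennreal (K m) * indicator (ball c (b m)) x \<partial>lborel) = ennreal (K m * ((b m)\<^sup>2 * pi))"
        using K[of m] by (simp add: nn_integral_cmult_indicator ennreal_mult)
    qed
    also have "\<dots> = ennreal (\<Sum>m. K m * ((b m)\<^sup>2 * pi))"
      using sm K by (intro suminf_ennreal2) auto
    finally show "(\<integral>\<^sup>+x. ennreal (log_kernel (dist c x)) * indicator (ball c q) x \<partial>lborel)
      \<le> ennreal (\<Sum>m. K m * ((b m)\<^sup>2 * pi))" .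
  qed
qed

subsection \<open>Logarithmic potentials\<close>

text \<open>Square roots of the coefficients are summed because the gradient estimate spends half a
  power of each coefficient against \<open>W N\<close>. The poles may coincide, so that a finite set
  can be enumerated too.\<close>

locale log_potential =
  fixes r :: real and c :: "nat \<Rightarrow> real" and z :: "nat \<Rightarrow> real^2"
  assumes r: "0 < r" "2 * r < 1"
    and c: "0 < c k" "c k \<le> 1"
    and z: "z k \<in> ball 0 r"
    and summable_c: "summable (\<lambda>k. sqrt (c k))"
begin

definition L :: "nat \<Rightarrow> real^2 \<Rightarrow> real" where
  "L k x = - ln (norm (x - z k))"

text \<open>The gradient of the logarithm of the distance to the pole, hence minus the gradient of
  \<open>L k\<close>.\<close>

definition p :: "nat \<Rightarrow> real^2 \<Rightarrow> real^2" where
  "p k x = (1 / (norm (x - z k))\<^sup>2) *\<^sub>R (x - z k)"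

definition W :: "nat \<Rightarrow> real^2 \<Rightarrow> real" where
  "W N x = (\<Sum>k\<le>N. c k * L k x)"

definition DW :: "nat \<Rightarrow> real^2 \<Rightarrow> real^2" where
  "DW N x = - (\<Sum>k\<le>N. c k *\<^sub>R p k x)"

definition w :: "real^2 \<Rightarrow> real" where
  "w x = (\<Sum>k. c k * L k x)"

definition Dw :: "real^2 \<Rightarrow> real^2" where
  "Dw x = - (\<Sum>k. c k *\<^sub>R p k x)"

definition G :: "real^2 \<Rightarrow> real" where
  "G x = (\<Sum>k. sqrt (c k) * log_kernel (dist (z k) x))"

text \<open>The points at which all series converge. Poles are excluded explicitly since summability
  does not detect them: the kernel has value 0 at its centre.\<close>

definition good :: "real^2 \<Rightarrow> bool" where
  "good x \<longleftrightarrow> x \<in> ball 0 r \<and> x \<notin> range z \<and> summable (\<lambda>k. sqrt (c k) * log_kernel (dist (z k) x))"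

text \<open>The contribution of the first pole alone, at the largest distance that two points of the
  ball can approach.\<close>

definition wmin :: real where
  "wmin = c 0 * - ln (2 * r)"

definition \<kappa> :: real where
  "\<kappa> = 1 / sqrt wmin"

lemma c_nonneg [simp]: "0 \<le> c k"
  using c(1) less_imp_le by blast

lemma wmin_pos: "0 < wmin"
  unfolding wmin_def using c[of 0] r by (intro mult_pos_pos) auto

lemma \<kappa>_pos: "0 < \<kappa>"
  using wmin_pos by (simp add: \<kappa>_def)

lemma norm_diff_pole:
  assumes "x \<in> ball 0 r"
  shows "norm (x - z k) < 2 * r" "norm (x - z k) < 1"
proof -
  show "norm (x - z k) < 2 * r"
    using norm_triangle_ineq4[of x "z k"] assms z[of k] by (simp add: dist_norm)
  with r show "norm (x - z k) < 1" by simp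
qed

lemma L_ge:
  assumes "x \<in> ball 0 r" "x \<noteq> z k"
  shows "- ln (2 * r) \<le> L k x" "0 < L k x"
proof -
  show "- ln (2 * r) \<le> L k x"
    using norm_diff_pole(1)[OF assms(1), of k] assms(2) r by (simp add: L_def)
  moreover have "0 < - ln (2 * r)" using r by simp
  ultimately show "0 < L k x" by linarith
qed

lemma W_ge:
  assumes "x \<in> ball 0 r" "x \<notin> z ` {..N}"
  shows "wmin \<le> W N x" "k \<le> N \<Longrightarrow> c k * L k x \<le> W N x"
proof -
  have nn: "0 \<le> c k * L k x" if "k \<in> {..N}" for k
    using L_ge(2)[OF assms(1), of k] that assms(2) by (intro mult_nonneg_nonneg) (auto simp: less_imp_le image_iff)
  show *: "c k * L k x \<le> W N x" if "k \<le> N" for k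
    unfolding W_def using that nn by (intro member_le_sum) auto
  have "wmin \<le> c 0 * L 0 x"
    unfolding wmin_def using c[of 0] L_ge(1)[OF assms(1), of 0] assms(2) by (intro mult_left_mono) auto
  also have "\<dots> \<le> W N x" by (rule *) simp
  finally show "wmin \<le> W N x" .
qed

lemma norm_p: "norm (p k x) = 1 / norm (x - z k)"
  by (simp add: p_def power2_eq_square)

lemma c_le_sqrt: "c k \<le> sqrt (c k)"
proof -
  have "c k = sqrt (c k) * sqrt (c k)" using c[of k] by simp
  also have "\<dots> \<le> sqrt (c k) * 1" using c[of k] by (intro mult_left_mono) auto
  finally show ?thesis by simp
qed

text \<open>Cauchy--Schwarz with the weights \<open>c k * L k x\<close>, followed by
  \<open>W N x \<ge> sqrt (c k * L k x) * sqrt wmin\<close>. A bound by the \<open>k\<close>-th term alone would lose the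
  factor \<open>sqrt (c k)\<close> that makes the sum over the poles converge.\<close>

lemma DW_bound:
  assumes "x \<in> ball 0 r" "x \<notin> z ` {..N}"
  shows "(norm (DW N x))\<^sup>2 \<le> \<kappa> * (\<Sum>k\<le>N. sqrt (c k) * log_kernel (dist (z k) x)) * (W N x)\<^sup>2"
proof -
  define t where "t = (\<lambda>k. norm (x - z k))"
  have x: "x \<noteq> z k" if "k \<le> N" for k using assms(2) that by auto
  have t: "0 < t k" "t k < 1" if "k \<le> N" for k
    using x[OF that] norm_diff_pole[OF assms(1), of k] by (auto simp: t_def)
  have L: "0 < L k x" if "k \<le> N" for k using L_ge[OF assms(1) x[OF that]] by simp
  have Wpos: "0 < W N x" using W_ge(1)[OF assms] wmin_pos by simp
  have "norm (DW N x) \<le> (\<Sum>k\<le>N. norm (c k *\<^sub>R p k x))"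
    unfolding DW_def norm_minus_cancel by (rule norm_sum)
  also have "\<dots> = (\<Sum>k\<le>N. sqrt (c k * L k x) * (sqrt (c k / L k x) / t k))"
  proof (intro sum.cong refl)
    fix k assume "k \<in> {..N}"
    then have k: "k \<le> N" by simp
    have "sqrt (c k * L k x) * sqrt (c k / L k x) = c k"
      using L[OF k] c[of k] by (simp flip: real_sqrt_mult add: field_simps)
    then show "norm (c k *\<^sub>R p k x) = sqrt (c k * L k x) * (sqrt (c k / L k x) / t k)"
      using c[of k] by (simp add: norm_p t_def)
  qed
  finally have "(norm (DW N x))\<^sup>2 \<le> (\<Sum>k\<le>N. sqrt (c k * L k x) * (sqrt (c k / L k x) / t k))\<^sup>2"
    by (intro power_mono) auto
  also have "\<dots> \<le> (\<Sum>k\<le>N. (sqrt (c k * L k x))\<^sup>2) * (\<Sum>k\<le>N. (sqrt (c k / L k x) / t k)\<^sup>2)"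
    by (rule Cauchy_Schwarz_ineq_sum)
  also have "(\<Sum>k\<le>N. (sqrt (c k * L k x))\<^sup>2) = W N x"
    unfolding W_def using L by (intro sum.cong) (auto simp: less_imp_le)
  also have "(\<Sum>k\<le>N. (sqrt (c k / L k x) / t k)\<^sup>2) \<le> (\<Sum>k\<le>N. \<kappa> * W N x * (sqrt (c k) * log_kernel (dist (z k) x)))"
  proof (intro sum_mono)
    fix k assume "k \<in> {..N}"
    then have k: "k \<le> N" by simp
    have "sqrt (c k * L k x) * sqrt wmin \<le> sqrt (W N x) * sqrt (W N x)"
      using W_ge(1)[OF assms] W_ge(2)[OF assms k] wmin_pos c[of k] L[OF k] by (intro mult_mono) auto
    then have a: "sqrt (c k) * sqrt (L k x) \<le> \<kappa> * W N x"
      using Wpos wmin_pos by (simp add: \<kappa>_def real_sqrt_mult field_simps)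
    \<comment> \<open>Half a power of the coefficient and half a power of the logarithm are split
      off, to be absorbed by \<open>a\<close>. This turns the exponent 1 of \<open>L k x\<close>
      into the exponent 3/2 of the kernel.\<close>
    have "(sqrt (c k / L k x) / t k)\<^sup>2 = sqrt (c k) * sqrt (L k x) * (sqrt (c k) / ((t k)\<^sup>2 * (L k x * sqrt (L k x))))"
    proof -
      have "(sqrt (c k / L k x) / t k)\<^sup>2 = (sqrt (c k) * sqrt (c k)) / (L k x) / (t k)\<^sup>2"
        using L[OF k] c[of k] by (simp add: power_divide)
      also have "\<dots> = sqrt (c k) * sqrt (L k x) * (sqrt (c k) / ((t k)\<^sup>2 * (L k x * sqrt (L k x))))"
        using L[OF k] by (simp del: real_sqrt_mult_self)
      finally show ?thesis .
    qed
    also have "\<dots> \<le> \<kappa> * W N x * (sqrt (c k) / ((t k)\<^sup>2 * (L k x * sqrt (L k x))))"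
      using a L[OF k] c[of k] by (intro mult_right_mono) auto
    also have "\<dots> = \<kappa> * W N x * (sqrt (c k) * log_kernel (dist (z k) x))"
      by (simp add: log_kernel_def t_def L_def dist_norm norm_minus_commute)
    finally show "(sqrt (c k / L k x) / t k)\<^sup>2 \<le> \<kappa> * W N x * (sqrt (c k) * log_kernel (dist (z k) x))" .
  qed
  then have "W N x * (\<Sum>k\<le>N. (sqrt (c k / L k x) / t k)\<^sup>2)
    \<le> W N x * (\<Sum>k\<le>N. \<kappa> * W N x * (sqrt (c k) * log_kernel (dist (z k) x)))"
    using Wpos by (intro mult_left_mono) auto
  also have "\<dots> = \<kappa> * (\<Sum>k\<le>N. sqrt (c k) * log_kernel (dist (z k) x)) * (W N x)\<^sup>2"
    by (simp add: sum_distrib_left sum_distrib_right power2_eq_square mult_ac)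
  finally show ?thesis by simp
qed

section \<open>Convergence and the integrable majorant\<close>

lemma goodD:
  assumes "good x"
  shows "x \<in> ball 0 r" "x \<noteq> z k" "summable (\<lambda>k. sqrt (c k) * log_kernel (dist (z k) x))"
  using assms by (auto simp: good_def)

lemma log_kernel_pole_nonneg: "x \<in> ball 0 r \<Longrightarrow> 0 \<le> log_kernel (dist (z k) x)"
  using norm_diff_pole(2)[of x k] by (intro log_kernel_nonneg) (auto simp: dist_norm norm_minus_commute)

lemma good_summable:
  assumes "good x"
  shows "summable (\<lambda>k. c k * L k x)" "summable (\<lambda>k. c k *\<^sub>R p k x)"
proof -
  have t: "0 < dist (z k) x" "dist (z k) x < 1" for k
    using goodD(2)[OF assms, of k] norm_diff_pole(2)[OF goodD(1)[OF assms], of k] by (auto simp: dist_norm norm_minus_commute)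
  have *: "c k * y \<le> 5 * (sqrt (c k) * log_kernel (dist (z k) x))" if "0 \<le> y" "y \<le> 5 * log_kernel (dist (z k) x)" for k y
  proof -
    have "c k * y \<le> sqrt (c k) * (5 * log_kernel (dist (z k) x))"
      using that c[of k] c_le_sqrt[of k] by (intro mult_mono) auto
    then show ?thesis by simp
  qed
  have s: "summable (\<lambda>k. 5 * (sqrt (c k) * log_kernel (dist (z k) x)))"
    using goodD(3)[OF assms] by (rule summable_mult)
  have tx: "norm (x - z k) = dist (z k) x" for k by (simp add: dist_norm norm_minus_commute)
  have "0 \<le> c k * L k x \<and> c k * L k x \<le> 5 * (sqrt (c k) * log_kernel (dist (z k) x))" for k
    using *[of "L k x" k] log_kernel_ge(2)[OF t, of k] L_ge(2)[OF goodD(1,2)[OF assms], of k]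
    unfolding L_def tx by (simp only: less_imp_le mult_nonneg_nonneg c_nonneg simp_thms)
  then show "summable (\<lambda>k. c k * L k x)"
    by (intro summable_comparison_test'[OF s, of 0]) simp
  have "norm (c k *\<^sub>R p k x) \<le> 5 * (sqrt (c k) * log_kernel (dist (z k) x))" for k
    using *[of "1 / dist (z k) x" k] log_kernel_ge(1)[OF t, of k] by (simp add: norm_p tx)
  then show "summable (\<lambda>k. c k *\<^sub>R p k x)"
    by (intro summable_comparison_test'[OF s, of 0]) simp
qed

lemma good_limits:
  assumes "good x"
  shows "(\<lambda>N. W N x) \<longlonglongrightarrow> w x" "(\<lambda>N. DW N x) \<longlonglongrightarrow> Dw x"
  using good_summable[OF assms] unfolding W_def DW_def w_def Dw_def
  by (auto intro!: tendsto_minus summable_LIMSEQ')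

lemma good_bounds:
  assumes "good x"
  shows "wmin \<le> W N x" "wmin \<le> w x" "0 \<le> G x"
    "(norm (DW N x))\<^sup>2 \<le> \<kappa> * G x * (W N x)\<^sup>2" "(norm (Dw x))\<^sup>2 \<le> \<kappa> * G x * (w x)\<^sup>2"
proof -
  have x: "x \<in> ball 0 r" "x \<notin> z ` {..N}" for N using assms by (auto simp: good_def)
  show 1: "wmin \<le> W N x" for N by (rule W_ge[OF x])
  show "wmin \<le> w x" by (rule LIMSEQ_le_const[OF good_limits(1)[OF assms]]) (use 1 in auto)
  have nn: "0 \<le> sqrt (c k) * log_kernel (dist (z k) x)" for k
    using log_kernel_pole_nonneg[OF x(1)] by (intro mult_nonneg_nonneg) auto
  show "0 \<le> G x" unfolding G_def using goodD(3)[OF assms] nn by (rule suminf_nonneg)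
  have "(\<Sum>k\<le>N. sqrt (c k) * log_kernel (dist (z k) x)) \<le> G x" for N
    unfolding G_def using goodD(3)[OF assms] nn by (intro sum_le_suminf) auto
  then have "\<kappa> * (\<Sum>k\<le>N. sqrt (c k) * log_kernel (dist (z k) x)) * (W N x)\<^sup>2 \<le> \<kappa> * G x * (W N x)\<^sup>2" for N
    using \<kappa>_pos by (intro mult_right_mono mult_left_mono) auto
  with DW_bound[OF x] show 2: "(norm (DW N x))\<^sup>2 \<le> \<kappa> * G x * (W N x)\<^sup>2" for N
    using order_trans by blast
  show "(norm (Dw x))\<^sup>2 \<le> \<kappa> * G x * (w x)\<^sup>2"
    by (rule LIMSEQ_le[of "\<lambda>N. (norm (DW N x))\<^sup>2" _ "\<lambda>N. \<kappa> * G x * (W N x)\<^sup>2"])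
       (use 2 good_limits[OF assms] in \<open>auto intro!: tendsto_intros\<close>)
qed

lemma borel_measurable_potential [measurable]:
  "w \<in> borel_measurable borel" "Dw \<in> borel_measurable borel" "G \<in> borel_measurable borel"
  "W N \<in> borel_measurable borel" "DW N \<in> borel_measurable borel"
  unfolding w_def Dw_def G_def W_def DW_def L_def p_def log_kernel_def by measurable

text \<open>Tonelli. Since \<open>ball 0 r\<close> lies in the disc of radius \<open>2 * r\<close>
  about every pole, all kernels have integrals below one constant, and only the sum of the
  \<open>sqrt (c k)\<close> remains. Working in the extended reals avoids presupposing
  convergence.\<close>

lemma nn_integral_log_kernel_sum:
  "(\<integral>\<^sup>+x. (\<Sum>k. ennreal (sqrt (c k) * log_kernel (dist (z k) x))) * indicator (ball 0 r) x \<partial>lborel) < \<infinity>"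
proof -
  obtain I where I: "0 \<le> I"
    "\<And>y :: real^2. (\<integral>\<^sup>+x. ennreal (log_kernel (dist y x)) * indicator (ball y (2 * r)) x \<partial>lborel) \<le> ennreal I"
    using nn_integral_log_kernel[of "2 * r"] r by auto
  have [measurable]: "ball a b \<in> sets borel" for a :: "real^2" and b by simp
  have [measurable]: "(\<lambda>x. log_kernel (dist (z k) x)) \<in> borel_measurable borel" for k
    unfolding log_kernel_def by measurable
  have "(\<integral>\<^sup>+x. (\<Sum>k. ennreal (sqrt (c k) * log_kernel (dist (z k) x))) * indicator (ball 0 r) x \<partial>lborel)
    = (\<integral>\<^sup>+x. (\<Sum>k. ennreal (sqrt (c k) * log_kernel (dist (z k) x)) * indicator (ball 0 r) x) \<partial>lborel)"
    by simp
  also have "\<dots> = (\<Sum>k. \<integral>\<^sup>+x. ennreal (sqrt (c k) * log_kernel (dist (z k) x)) * indicator (ball 0 r) x \<partial>lborel)"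
    by (intro nn_integral_suminf) measurable
  also have "\<dots> \<le> (\<Sum>k. ennreal (sqrt (c k) * I))"
  proof (intro suminf_le summableI allI)
    fix k
    have "(\<integral>\<^sup>+x. ennreal (sqrt (c k) * log_kernel (dist (z k) x)) * indicator (ball 0 r) x \<partial>lborel)
      \<le> (\<integral>\<^sup>+x. ennreal (sqrt (c k)) * (ennreal (log_kernel (dist (z k) x)) * indicator (ball (z k) (2 * r)) x) \<partial>lborel)"
    proof (rule nn_integral_mono)
      fix x
      show "ennreal (sqrt (c k) * log_kernel (dist (z k) x)) * indicator (ball 0 r) x
        \<le> ennreal (sqrt (c k)) * (ennreal (log_kernel (dist (z k) x)) * indicator (ball (z k) (2 * r)) x)"
      proof (cases "x \<in> ball 0 r")
        case True
        then show ?thesis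
          using norm_diff_pole(1)[OF True, of k] c[of k] log_kernel_pole_nonneg[OF True, of k]
          by (simp add: dist_norm norm_minus_commute ennreal_mult)
      qed simp
    qed
    also have "\<dots> = ennreal (sqrt (c k)) * (\<integral>\<^sup>+x. ennreal (log_kernel (dist (z k) x)) * indicator (ball (z k) (2 * r)) x \<partial>lborel)"
      by (intro nn_integral_cmult) measurable
    also have "\<dots> \<le> ennreal (sqrt (c k)) * ennreal I" using I(2) by (intro mult_left_mono) auto
    finally show "(\<integral>\<^sup>+x. ennreal (sqrt (c k) * log_kernel (dist (z k) x)) * indicator (ball 0 r) x \<partial>lborel)
      \<le> ennreal (sqrt (c k) * I)"
      using c[of k] I(1) by (simp add: ennreal_mult)
  qed
  also have "\<dots> = ennreal (\<Sum>k. sqrt (c k) * I)"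
    using I(1) summable_c by (intro suminf_ennreal2) (auto intro: summable_mult2)
  finally show ?thesis by (simp add: le_less_trans)
qed

text \<open>A series of nonnegative functions with finite integral is finite almost everywhere, and
  the poles are countable. This covers the case where the poles are dense in a set of positive
  measure.\<close>

lemma AE_good: "AE x in lebesgue_on (ball 0 r). good x"
  and integrable_G: "integrable (lebesgue_on (ball 0 r)) G"
proof -
  let ?S = "\<lambda>x. \<Sum>k. ennreal (sqrt (c k) * log_kernel (dist (z k) x))"
  have [measurable]: "ball a b \<in> sets borel" for a :: "real^2" and b by simp
  have [measurable]: "(\<lambda>x. log_kernel (dist (z k) x)) \<in> borel_measurable borel" for k
    unfolding log_kernel_def by measurable
  have m: "(\<lambda>x. ?S x * indicator (ball 0 r) x) \<in> borel_measurable lborel" by measurable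
  have "AE x in lborel. ?S x * indicator (ball 0 r) x \<noteq> \<infinity>"
    using nn_integral_log_kernel_sum by (intro nn_integral_PInf_AE[OF m]) auto
  moreover have "AE x in lborel. x \<notin> range z"
    by (intro AE_not_in countable_imp_null_set_lborel) auto
  ultimately have "AE x in lborel. x \<in> ball 0 r \<longrightarrow> good x"
  proof eventually_elim
    case (elim x)
    show ?case
    proof
      assume x: "x \<in> ball 0 r"
      have "summable (\<lambda>k. sqrt (c k) * log_kernel (dist (z k) x))"
        using elim(1) x log_kernel_pole_nonneg[OF x]
        by (intro summable_suminf_not_top) auto
      with x elim(2) show "good x" by (simp add: good_def)
    qed
  qed
  then have "AE x in lebesgue. x \<in> ball 0 r \<longrightarrow> good x" by (rule AE_completion)
  then show AE: "AE x in lebesgue_on (ball 0 r). good x" by (simp add: AE_restrict_space_iff)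
  show "integrable (lebesgue_on (ball 0 r)) G"
  proof (rule integrableI_bounded)
    show "G \<in> borel_measurable (lebesgue_on (ball 0 r))"
      by (intro measurable_restrict_space1 measurable_completion) simp
    have "(\<integral>\<^sup>+x. ennreal (norm (G x)) \<partial>lebesgue_on (ball 0 r)) = (\<integral>\<^sup>+x. ?S x \<partial>lebesgue_on (ball 0 r))"
    proof (rule nn_integral_cong_AE)
      show "AE x in lebesgue_on (ball 0 r). ennreal (norm (G x)) = ?S x"
        using AE
      proof eventually_elim
        case (elim x)
        then show ?case
          using good_bounds(3)[OF elim] log_kernel_pole_nonneg[OF goodD(1)[OF elim]]
          by (simp add: G_def suminf_ennreal2 goodD(3))
      qed
    qed
    also have "\<dots> = (\<integral>\<^sup>+x. ?S x * indicator (ball 0 r) x \<partial>lborel)"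
      by (simp add: nn_integral_restrict_space nn_integral_completion)
    finally show "(\<integral>\<^sup>+x. ennreal (norm (G x)) \<partial>lebesgue_on (ball 0 r)) < \<infinity>"
      using nn_integral_log_kernel_sum by simp
  qed
qed

end

section \<open>Directional derivatives and harmonicity of the finite sums\<close>

context log_potential
begin

definition D2W :: "nat \<Rightarrow> 2 \<Rightarrow> real^2 \<Rightarrow> real" where
  "D2W N i x = - (\<Sum>k\<le>N. c k * (1 / (norm (x - z k))\<^sup>2 - 2 * ((x - z k) $ i)\<^sup>2 / (norm (x - z k)) ^ 4))"

text \<open>Along a coordinate line the squared norm is a quadratic polynomial, so the derivatives
  of \<open>L k\<close> and \<open>p k\<close> reduce to one-variable calculus with
  \<open>ln\<close> and quotients.\<close>

lemma norm_line: "(norm (y + t *\<^sub>R axis i 1))\<^sup>2 = (norm y)\<^sup>2 + 2 * t * (y $ i) + t\<^sup>2"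
  for y :: "real^2"
  by (simp add: power2_norm_eq_inner inner_add_left inner_add_right inner_axis inner_axis' inner_axis_axis)
     (simp add: power2_eq_square algebra_simps)

lemma line_diff: "x + t *\<^sub>R e - z k = (x - z k) + t *\<^sub>R e"
  by simp

lemma L_deriv:
  assumes "x \<noteq> z k"
  shows "((\<lambda>t. L k (x + t *\<^sub>R axis i 1)) has_real_derivative - (p k x $ i)) (at 0)"
proof -
  define y where "y = x - z k"
  have y: "0 < norm y" using assms by (simp add: y_def)
  define q where "q = (\<lambda>t. (norm y)\<^sup>2 + 2 * t * (y $ i) + t\<^sup>2)"
  have "(q has_real_derivative 2 * (y $ i)) (at 0)"
    unfolding q_def by (auto intro!: derivative_eq_intros)
  moreover have "0 < q 0" using y by (simp add: q_def)
  ultimately have "((\<lambda>t. ln (q t)) has_real_derivative inverse (q 0) * (2 * (y $ i))) (at 0)"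
    by (intro DERIV_chain2[of ln _ q]) (auto intro: DERIV_ln)
  then have "((\<lambda>t. - (ln (q t) / 2)) has_real_derivative - (inverse (q 0) * (2 * (y $ i)) / 2)) (at 0)"
    by (intro DERIV_minus DERIV_cdivide)
  moreover have "L k (x + t *\<^sub>R axis i 1) = - (ln (q t) / 2)" for t
    unfolding L_def line_diff y_def[symmetric] q_def norm_line[symmetric] by (subst ln_sqrt[symmetric]) auto
  moreover have "inverse (q 0) * (2 * (y $ i)) / 2 = p k x $ i"
    unfolding p_def y_def[symmetric] q_def using y by (simp add: field_simps)
  ultimately show ?thesis by (simp only:)
qed

lemma p_deriv:
  assumes "x \<noteq> z k"
  shows "((\<lambda>t. p k (x + t *\<^sub>R axis i 1) $ i) has_real_derivative
    1 / (norm (x - z k))\<^sup>2 - 2 * ((x - z k) $ i)\<^sup>2 / (norm (x - z k)) ^ 4) (at 0)"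
proof -
  define y where "y = x - z k"
  have y: "0 < norm y" using assms by (simp add: y_def)
  have d: "((\<lambda>t. (norm y)\<^sup>2 + 2 * t * (y $ i) + t\<^sup>2) has_real_derivative 2 * (y $ i)) (at 0)"
    "((\<lambda>t. y $ i + t) has_real_derivative 1) (at 0)"
    by (auto intro!: derivative_eq_intros)
  have "((\<lambda>t. (y $ i + t) / ((norm y)\<^sup>2 + 2 * t * (y $ i) + t\<^sup>2)) has_real_derivative
    1 / (norm y)\<^sup>2 - 2 * (y $ i)\<^sup>2 / (norm y) ^ 4) (at 0)"
    by (rule DERIV_cong[OF DERIV_divide[OF d(2,1)]])
       (use y in \<open>simp_all add: diff_divide_distrib power2_eq_square power4_eq_xxxx mult_ac\<close>)
  moreover have "p k (x + t *\<^sub>R axis i 1) $ i = (y $ i + t) / ((norm y)\<^sup>2 + 2 * t * (y $ i) + t\<^sup>2)" for t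
    unfolding p_def line_diff y_def[symmetric] norm_line by simp
  ultimately show ?thesis by (simp only: y_def)
qed

lemma W_deriv:
  assumes "x \<notin> z ` {..N}"
  shows "((\<lambda>t. W N (x + t *\<^sub>R axis i 1)) has_real_derivative DW N x $ i) (at 0)"
    "((\<lambda>t. DW N (x + t *\<^sub>R axis i 1) $ i) has_real_derivative D2W N i x) (at 0)"
proof -
  have x: "x \<noteq> z k" if "k \<in> {..N}" for k using assms that by auto
  have "((\<lambda>t. W N (x + t *\<^sub>R axis i 1)) has_real_derivative (\<Sum>k\<le>N. c k * - (p k x $ i))) (at 0)"
    unfolding W_def by (intro DERIV_sum DERIV_cmult L_deriv x)
  then show "((\<lambda>t. W N (x + t *\<^sub>R axis i 1)) has_real_derivative DW N x $ i) (at 0)"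
    by (simp add: DW_def sum_component sum_negf)
  have "((\<lambda>t. - (\<Sum>k\<le>N. c k * (p k (x + t *\<^sub>R axis i 1) $ i))) has_real_derivative D2W N i x) (at 0)"
    unfolding D2W_def by (intro DERIV_minus DERIV_sum DERIV_cmult p_deriv x)
  then show "((\<lambda>t. DW N (x + t *\<^sub>R axis i 1) $ i) has_real_derivative D2W N i x) (at 0)"
    by (simp add: DW_def sum_component)
qed

text \<open>For each pole the two coordinate directions contribute
  \<open>2 / (norm y)\<^sup>2\<close>, which is exactly cancelled by the squares of the coordinates,
  as these add up to \<open>(norm y)\<^sup>2\<close>.\<close>

lemma W_harmonic:
  assumes "x \<notin> z ` {..N}"
  shows "(\<Sum>i\<in>UNIV. D2W N i x) = 0"
proof -
  have h: "(\<Sum>i\<in>UNIV. 1 / (norm y)\<^sup>2 - 2 * (y $ i)\<^sup>2 / (norm y) ^ 4) = 0" if "y \<noteq> 0" for y :: "real^2"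
  proof -
    have n: "(norm y)\<^sup>2 = (y $ 1)\<^sup>2 + (y $ 2)\<^sup>2"
      unfolding power2_norm_eq_inner by (simp add: inner_vec_def sum_2 power2_eq_square)
    have n4: "(norm y) ^ 4 = (norm y)\<^sup>2 * (norm y)\<^sup>2" by (simp add: power2_eq_square power4_eq_xxxx)
    have "(\<Sum>i\<in>UNIV. 1 / (norm y)\<^sup>2 - 2 * (y $ i)\<^sup>2 / (norm y) ^ 4)
        = 2 / (norm y)\<^sup>2 - 2 * ((y $ 1)\<^sup>2 + (y $ 2)\<^sup>2) / (norm y) ^ 4"
      by (simp add: sum_2 add_divide_distrib algebra_simps)
    also have "\<dots> = 0" unfolding n[symmetric] n4 using that by (simp add: power2_eq_square)
    finally show ?thesis .
  qed
  have "(\<Sum>i\<in>UNIV. 1 / (norm (x - z k))\<^sup>2 - 2 * ((x - z k) $ i)\<^sup>2 / (norm (x - z k)) ^ 4) = 0"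
    if "k \<le> N" for k
    by (rule h) (use assms that in auto)
  then have "(\<Sum>k\<le>N. c k * (\<Sum>i\<in>UNIV. 1 / (norm (x - z k))\<^sup>2 - 2 * ((x - z k) $ i)\<^sup>2 / (norm (x - z k)) ^ 4)) = 0"
    by (intro sum.neutral ballI) simp
  moreover have "(\<Sum>i\<in>UNIV. D2W N i x) = - (\<Sum>k\<le>N. c k * (\<Sum>i\<in>UNIV. 1 / (norm (x - z k))\<^sup>2 - 2 * ((x - z k) $ i)\<^sup>2 / (norm (x - z k)) ^ 4))"
    unfolding D2W_def sum_negf sum_distrib_left by (subst sum.swap) simp
  ultimately show ?thesis by simp
qed

lemma W_continuous:
  "continuous_on (S - z ` {..N}) (W N)" "continuous_on (S - z ` {..N}) (DW N)"
  "continuous_on (S - z ` {..N}) (D2W N i)"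
  unfolding W_def[abs_def] L_def DW_def[abs_def] p_def D2W_def[abs_def]
  by (auto intro!: continuous_intros)

text \<open>At distance \<open>exp (- M / c k)\<close> the single term of the pole
  \<open>z k\<close> reaches \<open>M\<close>, and the other terms are positive in the ball. Hence a
  function of \<open>W N\<close> that vanishes above \<open>M\<close> vanishes near all poles, as
  integration by parts demands.\<close>

lemma W_near_poles:
  obtains V where "open V" "z ` {..N} \<subseteq> V" "\<And>x. x \<in> V \<inter> ball 0 r - z ` {..N} \<Longrightarrow> M < W N x"
proof
  let ?V = "\<Union>k\<le>N. ball (z k) (exp (- M / c k))"
  show "open ?V" by auto
  show "z ` {..N} \<subseteq> ?V" by force
  fix x assume x: "x \<in> ?V \<inter> ball 0 r - z ` {..N}"
  then obtain k where k: "k \<le> N" "norm (x - z k) < exp (- M / c k)" "x \<noteq> z k"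
    by (auto simp: dist_norm norm_minus_commute)
  then have "ln (norm (x - z k)) < - M / c k"
    using ln_less_cancel_iff[of "norm (x - z k)" "exp (- M / c k)"] by simp
  then have "M < c k * L k x" using c(1)[of k] by (simp add: L_def field_simps)
  also have "\<dots> \<le> W N x" using x k by (intro W_ge) auto
  finally show "M < W N x" .
qed

end

subsection \<open>Passage to infinitely many poles\<close>

lemma integrable_lebesgue_on_ball_bounded:
  fixes f :: "'a::euclidean_space \<Rightarrow> 'b::{banach, second_countable_topology}"
  assumes "f \<in> borel_measurable borel" "AE x in lebesgue_on (ball a s). norm (f x) \<le> C"
  shows "integrable (lebesgue_on (ball a s)) f"
proof -
  have "finite_measure (lebesgue_on (ball a s))"
    using emeasure_lborel_ball_finite[of a s]
    by (intro finite_measureI) (simp add: emeasure_restrict_space less_top[symmetric])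
  moreover have "f \<in> borel_measurable (lebesgue_on (ball a s))"
    using assms(1) by (intro measurable_restrict_space1 measurable_completion) simp
  ultimately show ?thesis
    using assms(2) finite_measure.integrable_const_bound by blast
qed

context log_potential
begin

abbreviation (input) "\<mu> \<equiv> lebesgue_on (ball (0 :: real^2) r)"

lemma measurable_\<mu>: "f \<in> borel_measurable borel \<Longrightarrow> f \<in> borel_measurable \<mu>"
  by (intro measurable_restrict_space1 measurable_completion) simp

lemma integrable_\<mu>_G: "integrable \<mu> (\<lambda>x. C * (a + b * G x))"
proof -
  have "integrable \<mu> (\<lambda>x. C * a)"
    by (rule integrable_lebesgue_on_ball_bounded[where C = "\<bar>C * a\<bar>"]) auto
  moreover have "integrable \<mu> (\<lambda>x. (C * b) * G x)"
    by (intro integrable_mult_right integrable_G)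
  ultimately have "integrable \<mu> (\<lambda>x. C * a + (C * b) * G x)"
    by (rule Bochner_Integration.integrable_add)
  then show ?thesis by (simp only: distrib_left mult.assoc)
qed

text \<open>The first identity integrates the gradient of \<open>K (W N)\<close> by parts, the
  second the divergence of the field \<open>K (W N) DW N\<close>. By harmonicity that divergence is
  \<open>K' (W N) (norm (DW N))\<^sup>2\<close> alone. Vanishing of \<open>K\<close> and
  \<open>K'\<close> above \<open>M\<close> removes the poles.\<close>

lemma W_by_parts:
  assumes \<phi>: "\<phi> \<in> test_functions (ball 0 r)"
    and K: "\<And>s. 0 < s \<Longrightarrow> (K has_real_derivative K' s) (at s)"
    and K': "continuous_on {0<..} K'"
    and large: "\<And>s. M < s \<Longrightarrow> K s = 0" "\<And>s. M < s \<Longrightarrow> K' s = 0"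
  shows "has_bochner_integral \<mu>
      (\<lambda>x. gradient \<phi> x $ i * K (W N x) + \<phi> x * (K' (W N x) * DW N x $ i)) 0"
    and "has_bochner_integral \<mu>
      (\<lambda>x. K (W N x) * (DW N x \<bullet> gradient \<phi> x) + K' (W N x) * (norm (DW N x))\<^sup>2 * \<phi> x) 0"
proof -
  let ?P = "z ` {..N}"
  obtain V where V: "open V" "?P \<subseteq> V" "\<And>x. x \<in> V \<inter> ball 0 r - ?P \<Longrightarrow> M < W N x"
    using W_near_poles[of N M] by metis
  have pos: "0 < W N x" if "x \<in> ball 0 r - ?P" for x
    using W_ge(1)[of x N] that wmin_pos by auto
  have img: "W N ` (ball 0 r - ?P) \<subseteq> {0<..}" using pos by auto
  have "isCont K s" if "0 < s" for s using DERIV_isCont[OF K[OF that]] .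
  then have cK: "continuous_on {0<..} K" by (auto intro!: continuous_at_imp_continuous_on)
  note cont = continuous_on_compose2[OF cK W_continuous(1) img] continuous_on_compose2[OF K' W_continuous(1) img]
    W_continuous(2)[of "ball 0 r" N] W_continuous(3)[of "ball 0 r" N]
  have dK: "((\<lambda>t. K (W N (x + t *\<^sub>R axis i 1))) has_real_derivative K' (W N x) * DW N x $ i) (at 0)"
    if x: "x \<in> ball 0 r - ?P" for x i
    by (rule DERIV_chain2[where f = K]) (use K[OF pos[OF x]] W_deriv(1)[of x N i] x in simp_all)
  show "has_bochner_integral \<mu>
      (\<lambda>x. gradient \<phi> x $ i * K (W N x) + \<phi> x * (K' (W N x) * DW N x $ i)) 0"
  proof (rule test_function_integral_by_parts[OF \<phi> open_ball _ V(1,2)])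
    show "continuous_on (ball 0 r - ?P) (\<lambda>x. K' (W N x) * DW N x $ i)"
      by (intro continuous_on_mult continuous_on_component cont)
  qed (use V(3) large cont(1) dK in auto)
  have "has_bochner_integral \<mu> (\<lambda>x. gradient \<phi> x $ i * (K (W N x) * DW N x $ i)
      + \<phi> x * (K' (W N x) * DW N x $ i * DW N x $ i + K (W N x) * D2W N i x)) 0" for i
  proof (rule test_function_integral_by_parts[OF \<phi> open_ball _ V(1,2)])
    show "continuous_on (ball 0 r - ?P) (\<lambda>x. K (W N x) * DW N x $ i)"
      by (intro continuous_on_mult continuous_on_component cont)
    show "continuous_on (ball 0 r - ?P) (\<lambda>x. K' (W N x) * DW N x $ i * DW N x $ i + K (W N x) * D2W N i x)"
      by (intro continuous_on_mult continuous_on_add continuous_on_component cont)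
    show "((\<lambda>t. K (W N (x + t *\<^sub>R axis i 1)) * DW N (x + t *\<^sub>R axis i 1) $ i) has_real_derivative
      K' (W N x) * DW N x $ i * DW N x $ i + K (W N x) * D2W N i x) (at 0)" if x: "x \<in> ball 0 r - ?P" for x
      using DERIV_mult[OF dK[OF x, of i] W_deriv(2)[of x N i]] x by (simp add: mult_ac add_ac)
  qed (use V(3) large in auto)
  then have "has_bochner_integral \<mu> (\<lambda>x. \<Sum>i\<in>UNIV. gradient \<phi> x $ i * (K (W N x) * DW N x $ i)
      + \<phi> x * (K' (W N x) * DW N x $ i * DW N x $ i + K (W N x) * D2W N i x)) (\<Sum>i\<in>(UNIV::2 set). 0)"
    by (intro has_bochner_integral_sum)
  moreover have "(\<Sum>i\<in>UNIV. gradient \<phi> x $ i * (K (W N x) * DW N x $ i)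
      + \<phi> x * (K' (W N x) * DW N x $ i * DW N x $ i + K (W N x) * D2W N i x))
    = K (W N x) * (DW N x \<bullet> gradient \<phi> x) + K' (W N x) * (norm (DW N x))\<^sup>2 * \<phi> x + \<phi> x * K (W N x) * (\<Sum>i\<in>UNIV. D2W N i x)" for x
    unfolding power2_norm_eq_inner by (simp add: inner_vec_def sum_2 algebra_simps)
  ultimately have *: "has_bochner_integral \<mu> (\<lambda>x. K (W N x) * (DW N x \<bullet> gradient \<phi> x)
    + K' (W N x) * (norm (DW N x))\<^sup>2 * \<phi> x + \<phi> x * K (W N x) * (\<Sum>i\<in>UNIV. D2W N i x)) 0" by (simp only: sum.neutral_const)
  show "has_bochner_integral \<mu>
      (\<lambda>x. K (W N x) * (DW N x \<bullet> gradient \<phi> x) + K' (W N x) * (norm (DW N x))\<^sup>2 * \<phi> x) 0"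
  \<comment> \<open>Harmonicity is available only off the poles; these are finitely many points and
    do not affect the integral.\<close>
  proof (rule has_bochner_integral_discrete_difference[THEN iffD1, OF _ _ _ _ *])
    show "countable ?P" by simp
    fix x assume "x \<in> space \<mu>" "x \<notin> ?P"
    then show "K (W N x) * (DW N x \<bullet> gradient \<phi> x)
      + K' (W N x) * (norm (DW N x))\<^sup>2 * \<phi> x + \<phi> x * K (W N x) * (\<Sum>i\<in>UNIV. D2W N i x)
      = K (W N x) * (DW N x \<bullet> gradient \<phi> x) + K' (W N x) * (norm (DW N x))\<^sup>2 * \<phi> x"
      using W_harmonic[of x N] by (simp del: UNIV_2)
  next
    fix x assume "x \<in> ?P"
    then have "x \<in> ball 0 r" using z by auto
    then show "emeasure \<mu> {x} = 0" "{x} \<in> sets \<mu>"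
      by (auto simp: emeasure_restrict_space sets_restrict_space)
  qed
qed

text \<open>Some terms of the weak equation are linear in the gradient;
  \<open>a \<le> 1 + a\<^sup>2\<close> reduces them to the quadratic estimate.\<close>

lemma good_ratio_bounds:
  assumes "good x"
  shows "norm (DW N x) / W N x \<le> 1 + \<kappa> * G x" "(norm (DW N x) / W N x)\<^sup>2 \<le> \<kappa> * G x"
    "norm (Dw x) / w x \<le> 1 + \<kappa> * G x" "(norm (Dw x) / w x)\<^sup>2 \<le> \<kappa> * G x"
proof -
  have le: "a \<le> 1 + a\<^sup>2" for a :: real
    using zero_le_power2[of "a - 1/2"] by (simp add: power2_eq_square algebra_simps)
  have pos: "0 < W N x" "0 < w x" using good_bounds(1,2)[OF assms] wmin_pos by (auto intro: less_le_trans)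
  show 1: "(norm (DW N x) / W N x)\<^sup>2 \<le> \<kappa> * G x" "(norm (Dw x) / w x)\<^sup>2 \<le> \<kappa> * G x"
    using good_bounds(4,5)[OF assms] pos by (simp_all add: power_divide pos_divide_le_eq)
  show "norm (DW N x) / W N x \<le> 1 + \<kappa> * G x" "norm (Dw x) / w x \<le> 1 + \<kappa> * G x"
    using le order_trans add_left_mono[OF 1(1), of 1] add_left_mono[OF 1(2), of 1] by blast+
qed

text \<open>These are the weak forms of the chain rule for \<open>H (w)\<close> and of
  \<open>\<Delta> (H (w)) = H2 (w) |Dw|\<^sup>2\<close>, valid for harmonic \<open>w\<close>. The
  bounds on \<open>H\<close>, \<open>H1\<close>, \<open>H2\<close> have the homogeneity of functions
  of \<open>ln s\<close>; they turn every integrand into a multiple of the ratio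
  \<open>norm d / s\<close> or of its square.\<close>

lemma weak_identities:
  fixes H H1 H2 :: "real \<Rightarrow> real"
  assumes \<phi>: "\<phi> \<in> test_functions (ball 0 r)"
    and dH: "\<And>s. 0 < s \<Longrightarrow> (H has_real_derivative H1 s) (at s)"
    and dH1: "\<And>s. 0 < s \<Longrightarrow> (H1 has_real_derivative H2 s) (at s)"
    and cH2: "continuous_on {0<..} H2"
    and bounds: "\<And>s. 0 < s \<Longrightarrow> \<bar>H s\<bar> \<le> 1" "\<And>s. 0 < s \<Longrightarrow> \<bar>H1 s\<bar> \<le> 1 / s" "\<And>s. 0 < s \<Longrightarrow> \<bar>H2 s\<bar> \<le> 2 / s\<^sup>2"
    and meas[measurable]: "H \<in> borel_measurable borel" "H1 \<in> borel_measurable borel" "H2 \<in> borel_measurable borel"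
  shows "(LINT x|\<mu>. H (w x) * gradient \<phi> x $ i) = - (LINT x|\<mu>. (H1 (w x) *\<^sub>R Dw x) $ i * \<phi> x)"
    and "integrable \<mu> (\<lambda>x. H2 (w x) * (norm (Dw x))\<^sup>2 * \<phi> x)"
    and "(LINT x|\<mu>. (H1 (w x) *\<^sub>R Dw x) \<bullet> gradient \<phi> x) = - (LINT x|\<mu>. H2 (w x) * (norm (Dw x))\<^sup>2 * \<phi> x)"
proof -
  obtain C where C: "0 \<le> C" "\<And>x. \<bar>\<phi> x\<bar> \<le> C" "\<And>x. norm (gradient \<phi> x) \<le> C"
    using test_function_bounded[OF \<phi>] by blast
  have Ci: "\<bar>gradient \<phi> x $ i\<bar> \<le> C" for x using component_le_norm_cart[of "gradient \<phi> x" i] C(3)[of x] by linarith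
  note grad = test_function_gradient[OF \<phi>]
  have [measurable]: "\<phi> \<in> borel_measurable borel" "gradient \<phi> \<in> borel_measurable borel"
    using grad(1,2) by (auto intro: borel_measurable_continuous_onI)
  note [measurable] = borel_measurable_component
  \<comment> \<open>The level of the cutoff is \<open>N + 1\<close>, tied to the number of poles so
    that a single limit suffices.\<close>
  define m where "m = (\<lambda>N. inverse (real (Suc N)))"
  have m: "0 < m N" for N by (simp add: m_def)
  have large: "cut (m N) s = 0 \<and> cut' (m N) s = 0" if "real (Suc N) < s" for N s
    using that cut_eq_0[of "m N" s] by (simp add: m_def field_simps)
  have cont: "continuous_on {0<..} H" "continuous_on {0<..} H1"
    using DERIV_isCont[OF dH] DERIV_isCont[OF dH1] by (auto intro!: continuous_at_imp_continuous_on)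
  have contc: "continuous_on A (cut (m N))" "continuous_on A (cut' (m N))" for A N
    using continuous_cut[OF continuous_on_id, of A "m N"] by simp_all
  \<comment> \<open>The constants are the worst cases of the bounds in \<open>est\<close>: with
    \<open>g\<close> for \<open>\<kappa> * G x\<close>, the first integrand is at most
    \<open>C\<close> times \<open>1 + 3 * (1 + g)\<close>, the second at most \<open>C\<close> times
    \<open>(1 + g) + 4 * g\<close>.\<close>
  define dom where "dom = (\<lambda>x. C * (4 + (5 * \<kappa>) * G x))"
  have dom: "integrable \<mu> dom" unfolding dom_def by (rule integrable_\<mu>_G)

  text \<open>Stated for arbitrary values \<open>s\<close> and \<open>d\<close> to cover the finite sums as well as their limit.\<close>
  have est: "\<bar>g * (H s * \<eta>) + f * ((H1 s * \<eta> + H s * \<eta>') * d $ i)\<bar> \<le> dom x"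
      "\<bar>(H1 s * \<eta>) * (d \<bullet> gradient \<phi> x) + (H2 s * \<eta> + H1 s * \<eta>') * (norm d)\<^sup>2 * f\<bar> \<le> dom x"
      "\<bar>H1 s * d $ i * f\<bar> \<le> dom x" "\<bar>H2 s * (norm d)\<^sup>2 * f\<bar> \<le> dom x"
    if s: "0 < s" and d: "norm d / s \<le> 1 + \<kappa> * G x" "(norm d / s)\<^sup>2 \<le> \<kappa> * G x"
      and \<eta>: "0 \<le> \<eta>" "\<eta> \<le> 1" "\<bar>\<eta>'\<bar> \<le> 2 / s" and g: "\<bar>g\<bar> \<le> C" and f: "\<bar>f\<bar> \<le> C"
    for s x \<eta> \<eta>' g f and d :: "real^2"
  proof -
    have kG: "0 \<le> \<kappa> * G x" using d(2) zero_le_power2 order_trans by blast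
    have H1\<eta>: "\<bar>H1 s * \<eta>\<bar> \<le> 1 / s"
      using mult_mono[OF bounds(2)[OF s] \<eta>(2)] s \<eta> by (simp add: abs_mult)
    have H\<eta>': "\<bar>H s * \<eta>'\<bar> \<le> 2 / s"
      using mult_mono[OF bounds(1)[OF s] \<eta>(3)] s by (simp add: abs_mult)
    have H1\<eta>': "\<bar>H1 s * \<eta>'\<bar> \<le> 2 / s\<^sup>2"
      using mult_mono[OF bounds(2)[OF s] \<eta>(3)] s by (simp add: abs_mult power2_eq_square)
    have H2\<eta>: "\<bar>H2 s * \<eta>\<bar> \<le> 2 / s\<^sup>2"
      using mult_mono[OF bounds(3)[OF s] \<eta>(2)] s \<eta> by (simp add: abs_mult)
    have di: "\<bar>d $ i\<bar> \<le> norm d" by (rule component_le_norm_cart)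
    have first: "\<bar>a * e * f\<bar> \<le> b * C * (1 + \<kappa> * G x)" if "\<bar>a\<bar> \<le> b / s" "\<bar>e\<bar> \<le> norm d" "0 \<le> b" "\<bar>f\<bar> \<le> C" for a b e f
    proof -
      have "\<bar>a * e * f\<bar> \<le> (b / s) * norm d * C"
        unfolding abs_mult using that s C(1) by (intro mult_mono) auto
      also have "\<dots> = b * C * (norm d / s)" by simp
      also have "\<dots> \<le> b * C * (1 + \<kappa> * G x)" using d(1) that C(1) by (intro mult_left_mono) auto
      finally show ?thesis .
    qed
    have second: "\<bar>a * (norm d)\<^sup>2 * f\<bar> \<le> b * C * (\<kappa> * G x)" if "\<bar>a\<bar> \<le> b / s\<^sup>2" "0 \<le> b" for a b
    proof -
      have "\<bar>a * (norm d)\<^sup>2 * f\<bar> \<le> (b / s\<^sup>2) * (norm d)\<^sup>2 * C"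
        unfolding abs_mult using that f C(1) by (intro mult_mono) auto
      also have "\<dots> = b * C * (norm d / s)\<^sup>2" by (simp add: power_divide)
      also have "\<dots> \<le> b * C * (\<kappa> * G x)" using d(2) that C(1) by (intro mult_left_mono) auto
      finally show ?thesis .
    qed
    have CkG: "0 \<le> C * (\<kappa> * G x)" using kG C(1) by simp
    have D: "dom x = 4 * C + 5 * (C * (\<kappa> * G x))" by (simp add: dom_def algebra_simps)
    have "\<bar>H s * \<eta>\<bar> \<le> 1 * 1"
      using mult_mono[OF bounds(1)[OF s] \<eta>(2)] \<eta> by (simp add: abs_mult)
    then have "\<bar>g * (H s * \<eta>)\<bar> \<le> C * 1"
      unfolding abs_mult[of g] using g C(1) by (intro mult_mono) auto
    moreover have "\<bar>(H1 s * \<eta> + H s * \<eta>') * d $ i * f\<bar> \<le> 3 * C * (1 + \<kappa> * G x)"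
      using H1\<eta> H\<eta>' by (intro first[OF _ di _ f]) (auto simp: add_divide_distrib[symmetric] intro: order_trans[OF abs_triangle_ineq])
    moreover have "g * (H s * \<eta>) + f * ((H1 s * \<eta> + H s * \<eta>') * d $ i)
      = g * (H s * \<eta>) + (H1 s * \<eta> + H s * \<eta>') * d $ i * f" by (simp add: mult_ac)
    ultimately show "\<bar>g * (H s * \<eta>) + f * ((H1 s * \<eta> + H s * \<eta>') * d $ i)\<bar> \<le> dom x"
      using CkG unfolding D by (simp add: algebra_simps)
    have "\<bar>d \<bullet> gradient \<phi> x\<bar> \<le> norm d * C"
      using Cauchy_Schwarz_ineq2[of d "gradient \<phi> x"] mult_left_mono[OF C(3)[of x], of "norm d"] by simp
    then have "\<bar>(H1 s * \<eta>) * (d \<bullet> gradient \<phi> x)\<bar> \<le> (1 / s) * (norm d * C)"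
      unfolding abs_mult[of "H1 s * \<eta>"] using H1\<eta> s by (intro mult_mono) auto
    also have "\<dots> = C * (norm d / s)" by simp
    also have "\<dots> \<le> C * (1 + \<kappa> * G x)" using d(1) C(1) by (rule mult_left_mono)
    finally have "\<bar>(H1 s * \<eta>) * (d \<bullet> gradient \<phi> x)\<bar> \<le> C + C * (\<kappa> * G x)" by (simp add: algebra_simps)
    moreover have "\<bar>(H2 s * \<eta> + H1 s * \<eta>') * (norm d)\<^sup>2 * f\<bar> \<le> 4 * C * (\<kappa> * G x)"
      using H2\<eta> H1\<eta>' by (intro second) (auto simp: add_divide_distrib[symmetric] intro: order_trans[OF abs_triangle_ineq])
    ultimately show "\<bar>(H1 s * \<eta>) * (d \<bullet> gradient \<phi> x) + (H2 s * \<eta> + H1 s * \<eta>') * (norm d)\<^sup>2 * f\<bar> \<le> dom x"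
      using CkG C(1) unfolding D by linarith
    show "\<bar>H1 s * d $ i * f\<bar> \<le> dom x"
      using first[OF _ di _ f, of "H1 s" 1] bounds(2)[OF s] CkG C(1) unfolding D by (simp add: algebra_simps)
    show "\<bar>H2 s * (norm d)\<^sup>2 * f\<bar> \<le> dom x"
      using second[of "H2 s" 2] bounds(3)[OF s] CkG C(1) unfolding D by simp
  qed

  \<comment> \<open>\<open>X N\<close> and \<open>Y N\<close> are the integrands of
    \<open>W_by_parts\<close> for the products of \<open>cut (m N)\<close> with \<open>H\<close> and
    with \<open>H1\<close>. In the limit the cutoff becomes 1 and its slope 0, which leaves
    \<open>X'\<close> and \<open>Y'\<close>.\<close>
  define X where "X = (\<lambda>N x. gradient \<phi> x $ i * (H (W N x) * cut (m N) (W N x))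
    + \<phi> x * ((H1 (W N x) * cut (m N) (W N x) + H (W N x) * cut' (m N) (W N x)) * DW N x $ i))"
  define Y where "Y = (\<lambda>N x. (H1 (W N x) * cut (m N) (W N x)) * (DW N x \<bullet> gradient \<phi> x)
    + (H2 (W N x) * cut (m N) (W N x) + H1 (W N x) * cut' (m N) (W N x)) * (norm (DW N x))\<^sup>2 * \<phi> x)"
  define X' where "X' = (\<lambda>x. gradient \<phi> x $ i * H (w x) + \<phi> x * (H1 (w x) * Dw x $ i))"
  define Y' where "Y' = (\<lambda>x. H1 (w x) * (Dw x \<bullet> gradient \<phi> x) + H2 (w x) * (norm (Dw x))\<^sup>2 * \<phi> x)"
  have X0: "integral\<^sup>L \<mu> (X N) = 0" for N
    unfolding X_def
    by (rule has_bochner_integral_integral_eq, rule W_by_parts(1)[OF \<phi>, where M = "real (Suc N)"])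
       (use large in \<open>auto intro!: derivative_eq_intros dH DERIV_cut continuous_intros cont contc\<close>)
  have Y0: "integral\<^sup>L \<mu> (Y N) = 0" for N
    unfolding Y_def
    by (rule has_bochner_integral_integral_eq, rule W_by_parts(2)[OF \<phi>, where M = "real (Suc N)"])
       (use large in \<open>auto intro!: derivative_eq_intros dH1 DERIV_cut continuous_intros cont contc cH2\<close>)
  have measXY: "X N \<in> borel_measurable \<mu>" "Y N \<in> borel_measurable \<mu>" for N
    unfolding X_def Y_def by (intro measurable_\<mu>; measurable)+
  have measXY': "X' \<in> borel_measurable \<mu>" "Y' \<in> borel_measurable \<mu>"
    unfolding X'_def Y'_def by (intro measurable_\<mu>; measurable)+
  have pos: "0 < W N x" "0 < w x" if "good x" for N x
    using good_bounds(1,2)[OF that] wmin_pos by (auto intro: less_le_trans)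
  have bnd: "AE x in \<mu>. norm (X N x) \<le> dom x" for N
    using AE_good
  proof eventually_elim
    case (elim x)
    show ?case unfolding X_def real_norm_def
      by (intro est pos good_ratio_bounds cut_bounds m Ci C(2) elim)
  qed
  have bnd': "AE x in \<mu>. norm (Y N x) \<le> dom x" for N
    using AE_good
  proof eventually_elim
    case (elim x)
    show ?case unfolding Y_def real_norm_def
      by (intro est(2)[where g = 0] pos good_ratio_bounds cut_bounds m C elim) (simp add: C)
  qed
  have lim: "AE x in \<mu>. (\<lambda>N. X N x) \<longlonglongrightarrow> X' x" "AE x in \<mu>. (\<lambda>N. Y N x) \<longlonglongrightarrow> Y' x"
  proof -
    have "(\<lambda>N. X N x) \<longlonglongrightarrow> X' x \<and> (\<lambda>N. Y N x) \<longlonglongrightarrow> Y' x" if x: "good x" for x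
    proof -
      note lims = good_limits[OF x]
      have HW: "(\<lambda>N. H (W N x)) \<longlonglongrightarrow> H (w x)" "(\<lambda>N. H1 (W N x)) \<longlonglongrightarrow> H1 (w x)" "(\<lambda>N. H2 (W N x)) \<longlonglongrightarrow> H2 (w x)"
        using pos(2)[OF x] cont cH2
        by (auto intro!: isCont_tendsto_compose[OF _ lims(1)] simp: continuous_on_eq_continuous_at)
      have cutl: "(\<lambda>N. cut (m N) (W N x)) \<longlonglongrightarrow> 1" "(\<lambda>N. cut' (m N) (W N x)) \<longlonglongrightarrow> 0"
        using tendsto_cut[OF lims(1)] by (simp_all add: m_def)
      have "(\<lambda>N. X N x) \<longlonglongrightarrow> gradient \<phi> x $ i * (H (w x) * 1) + \<phi> x * ((H1 (w x) * 1 + H (w x) * 0) * Dw x $ i)"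
        unfolding X_def by (intro tendsto_intros HW cutl lims)
      moreover have "(\<lambda>N. Y N x) \<longlonglongrightarrow> (H1 (w x) * 1) * (Dw x \<bullet> gradient \<phi> x)
          + (H2 (w x) * 1 + H1 (w x) * 0) * (norm (Dw x))\<^sup>2 * \<phi> x"
        unfolding Y_def by (intro tendsto_intros HW cutl lims)
      ultimately show ?thesis by (simp add: X'_def Y'_def)
    qed
    then show "AE x in \<mu>. (\<lambda>N. X N x) \<longlonglongrightarrow> X' x" "AE x in \<mu>. (\<lambda>N. Y N x) \<longlonglongrightarrow> Y' x"
      using AE_good by (auto elim!: eventually_mono)
  qed
  have "(\<lambda>N. integral\<^sup>L \<mu> (X N)) \<longlonglongrightarrow> integral\<^sup>L \<mu> X'"
    by (rule integral_dominated_convergence[OF measXY'(1) measXY(1) dom lim(1) bnd])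
  then have iX': "integral\<^sup>L \<mu> X' = 0" by (simp add: X0 LIMSEQ_const_iff)
  have "(\<lambda>N. integral\<^sup>L \<mu> (Y N)) \<longlonglongrightarrow> integral\<^sup>L \<mu> Y'"
    by (rule integral_dominated_convergence[OF measXY'(2) measXY(2) dom lim(2) bnd'])
  then have iY': "integral\<^sup>L \<mu> Y' = 0" by (simp add: Y0 LIMSEQ_const_iff)
  have intX': "integrable \<mu> X'"
    by (rule integrable_dominated_convergence[OF measXY'(1) measXY(1) dom lim(1) bnd])
  have intY': "integrable \<mu> Y'"
    by (rule integrable_dominated_convergence[OF measXY'(2) measXY(2) dom lim(2) bnd'])
  \<comment> \<open>The integrals of \<open>X'\<close> and \<open>Y'\<close> vanish, but splitting
    them into two summands needs one summand to be integrable on its own.\<close>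
  have A: "integrable \<mu> (\<lambda>x. H1 (w x) * Dw x $ i * \<phi> x)"
  proof (rule Bochner_Integration.integrable_bound[OF dom])
    show "(\<lambda>x. H1 (w x) * Dw x $ i * \<phi> x) \<in> borel_measurable \<mu>" by (intro measurable_\<mu>; measurable)
    show "AE x in \<mu>. norm (H1 (w x) * Dw x $ i * \<phi> x) \<le> norm (dom x)"
      using AE_good
    proof eventually_elim
      case (elim x)
      have "\<bar>H1 (w x) * Dw x $ i * \<phi> x\<bar> \<le> dom x"
        by (rule est(3)[OF pos(2)[OF elim] good_ratio_bounds(3,4)[OF elim], of 0 0 0]) (use C pos(2)[OF elim] in auto)
      then show ?case by simp
    qed
  qed
  show B: "integrable \<mu> (\<lambda>x. H2 (w x) * (norm (Dw x))\<^sup>2 * \<phi> x)"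
  proof (rule Bochner_Integration.integrable_bound[OF dom])
    show "(\<lambda>x. H2 (w x) * (norm (Dw x))\<^sup>2 * \<phi> x) \<in> borel_measurable \<mu>" by (intro measurable_\<mu>; measurable)
    show "AE x in \<mu>. norm (H2 (w x) * (norm (Dw x))\<^sup>2 * \<phi> x) \<le> norm (dom x)"
      using AE_good
    proof eventually_elim
      case (elim x)
      have "\<bar>H2 (w x) * (norm (Dw x))\<^sup>2 * \<phi> x\<bar> \<le> dom x"
        by (rule est(4)[OF pos(2)[OF elim] good_ratio_bounds(3,4)[OF elim], of 0 0 0]) (use C pos(2)[OF elim] in auto)
      then show ?case by simp
    qed
  qed
  have "(LINT x|\<mu>. H (w x) * gradient \<phi> x $ i) = (LINT x|\<mu>. X' x - H1 (w x) * Dw x $ i * \<phi> x)"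
    by (intro Bochner_Integration.integral_cong) (auto simp: X'_def mult_ac)
  also have "\<dots> = - (LINT x|\<mu>. H1 (w x) * Dw x $ i * \<phi> x)"
    using Bochner_Integration.integral_diff[OF intX' A] iX' by simp
  finally show "(LINT x|\<mu>. H (w x) * gradient \<phi> x $ i) = - (LINT x|\<mu>. (H1 (w x) *\<^sub>R Dw x) $ i * \<phi> x)" by simp
  have "(LINT x|\<mu>. (H1 (w x) *\<^sub>R Dw x) \<bullet> gradient \<phi> x) = (LINT x|\<mu>. Y' x - H2 (w x) * (norm (Dw x))\<^sup>2 * \<phi> x)"
    by (intro Bochner_Integration.integral_cong) (auto simp: Y'_def mult_ac)
  also have "\<dots> = - (LINT x|\<mu>. H2 (w x) * (norm (Dw x))\<^sup>2 * \<phi> x)"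
    using Bochner_Integration.integral_diff[OF intY' B] iY' by simp
  finally show "(LINT x|\<mu>. (H1 (w x) *\<^sub>R Dw x) \<bullet> gradient \<phi> x) = - (LINT x|\<mu>. H2 (w x) * (norm (Dw x))\<^sup>2 * \<phi> x)" .
qed

end

subsection \<open>Smoothness away from the poles\<close>

text \<open>Complex notation is introduced so that holomorphy of one series supplies all higher
  derivatives at once, in place of termwise differentiation at every order.\<close>

definition to_complex :: "real^2 \<Rightarrow> complex" where
  "to_complex x = Complex (x $ 1) (x $ 2)"

lemma bounded_linear_to_complex: "bounded_linear to_complex"
proof (rule bounded_linear_intro[where K = 1])
  show "norm (to_complex x) \<le> norm x * 1" for x
    by (simp add: to_complex_def complex_norm norm_vec_def L2_set_def sum_2)
qed (simp_all add: to_complex_def complex_eq_iff)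

lemma norm_to_complex: "cmod (to_complex x) = norm x"
  by (simp add: to_complex_def complex_norm norm_vec_def L2_set_def sum_2)

lemma to_complex_diff: "to_complex (x - y) = to_complex x - to_complex y"
  by (simp add: to_complex_def complex_eq_iff)

text \<open>The directional derivative of \<open>ln (norm y)\<close> is the real part of a complex
  quotient, that is, of the Cauchy kernel.\<close>

lemma inner_scaled_eq_Re_divide:
  assumes "y \<noteq> 0"
  shows "((1 / (norm y)\<^sup>2) *\<^sub>R y) \<bullet> v = Re (to_complex v / to_complex y)"
proof -
  have "(norm y)\<^sup>2 = (y $ 1)\<^sup>2 + (y $ 2)\<^sup>2"
    unfolding power2_norm_eq_inner by (simp add: inner_vec_def sum_2 power2_eq_square)
  then show ?thesis
    by (simp add: Re_divide to_complex_def inner_vec_def sum_2 add_divide_distrib mult.commute)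
qed

text \<open>The smallest algebra of functions that contains the solution \<open>sin (ln w)\<close>, \<open>cos (ln w)\<close> and is
  closed under directional derivatives, when \<open>w\<close> has the derivative \<open>\<lambda>v. - Re (v * g)\<close>
  with \<open>g\<close> holomorphic.\<close>

inductive_set derivative_algebra ::
    "(real^2 \<Rightarrow> real) \<Rightarrow> (complex \<Rightarrow> complex) \<Rightarrow> (real^2 \<Rightarrow> real) set"
  for w :: "real^2 \<Rightarrow> real" and g :: "complex \<Rightarrow> complex" where
  sin: "(\<lambda>x. sin (ln (w x))) \<in> derivative_algebra w g"
| cos: "(\<lambda>x. cos (ln (w x))) \<in> derivative_algebra w g"
| inverse: "(\<lambda>x. inverse (w x)) \<in> derivative_algebra w g"
| Re: "(\<lambda>x. Re (a * (deriv ^^ n) g (to_complex x))) \<in> derivative_algebra w g"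
| const: "(\<lambda>x. a) \<in> derivative_algebra w g"
| add: "f \<in> derivative_algebra w g \<Longrightarrow> h \<in> derivative_algebra w g \<Longrightarrow> (\<lambda>x. f x + h x) \<in> derivative_algebra w g"
| mult: "f \<in> derivative_algebra w g \<Longrightarrow> h \<in> derivative_algebra w g \<Longrightarrow> (\<lambda>x. f x * h x) \<in> derivative_algebra w g"

lemma derivative_algebra_step:
  assumes g: "g holomorphic_on T" "open T" "\<And>x. x \<in> S \<Longrightarrow> to_complex x \<in> T"
    and w: "\<And>x. x \<in> S \<Longrightarrow> 0 < w x"
      "\<And>x. x \<in> S \<Longrightarrow> (w has_derivative (\<lambda>v. Re (- to_complex v * g (to_complex x)))) (at x)"
    and "f \<in> derivative_algebra w g"
  shows "\<exists>D. (\<forall>x\<in>S. (f has_derivative D x) (at x)) \<and>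
    (\<forall>v. \<exists>h\<in>derivative_algebra w g. \<forall>x\<in>S. D x v = h x)"
  using assms(6)
proof induction
  case sin
  have "((\<lambda>x. sin (ln (w x))) has_derivative
      (\<lambda>v. cos (ln (w x)) * (inverse (w x) * Re (- to_complex v * g (to_complex x))))) (at x)" if "x \<in> S" for x
    using w[OF that] by (auto intro!: derivative_eq_intros simp: field_simps)
  \<comment> \<open>\<open>(deriv ^^ 0) g\<close> is \<open>g\<close>, written in the shape produced
    by the generator \<open>Re\<close>.\<close>
  moreover have "(\<lambda>x. cos (ln (w x)) * (inverse (w x) * Re (- to_complex v * (deriv ^^ 0) g (to_complex x)))) \<in> derivative_algebra w g" for v
    by (intro derivative_algebra.intros)
  ultimately show ?case
    by (intro exI[of _ "\<lambda>x v. cos (ln (w x)) * (inverse (w x) * Re (- to_complex v * g (to_complex x)))"]) force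
next
  case cos
  have "((\<lambda>x. cos (ln (w x))) has_derivative
      (\<lambda>v. - 1 * (sin (ln (w x)) * (inverse (w x) * Re (- to_complex v * g (to_complex x)))))) (at x)" if "x \<in> S" for x
    using w[OF that] by (auto intro!: derivative_eq_intros simp: field_simps)
  moreover have "(\<lambda>x. - 1 * (sin (ln (w x)) * (inverse (w x) * Re (- to_complex v * (deriv ^^ 0) g (to_complex x))))) \<in> derivative_algebra w g" for v
    by (intro derivative_algebra.intros)
  ultimately show ?case
    by (intro exI[of _ "\<lambda>x v. - 1 * (sin (ln (w x)) * (inverse (w x) * Re (- to_complex v * g (to_complex x))))"]) force
next
  case inverse
  have "((\<lambda>x. inverse (w x)) has_derivative
      (\<lambda>v. - 1 * (inverse (w x) * (inverse (w x) * Re (- to_complex v * g (to_complex x)))))) (at x)" if "x \<in> S" for x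
    using w[OF that] by (auto intro!: derivative_eq_intros simp: field_simps)
  moreover have "(\<lambda>x. - 1 * (inverse (w x) * (inverse (w x) * Re (- to_complex v * (deriv ^^ 0) g (to_complex x))))) \<in> derivative_algebra w g" for v
    by (intro derivative_algebra.intros)
  ultimately show ?case
    by (intro exI[of _ "\<lambda>x v. - 1 * (inverse (w x) * (inverse (w x) * Re (- to_complex v * g (to_complex x))))"]) force
next
  case (Re a n)
  have "((\<lambda>x. Re (a * (deriv ^^ n) g (to_complex x))) has_derivative
      (\<lambda>v. Re ((a * to_complex v) * (deriv ^^ Suc n) g (to_complex x)))) (at x)" if "x \<in> S" for x
  proof -
    have "(deriv ^^ n) g holomorphic_on T" using g(1,2) by (rule holomorphic_higher_deriv)
    then have "((deriv ^^ n) g has_field_derivative (deriv ^^ Suc n) g (to_complex x)) (at (to_complex x))"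
      using holomorphic_derivI[OF _ g(2) g(3)[OF that]] by simp
    then have "((\<lambda>x. (deriv ^^ n) g (to_complex x)) has_derivative
        (\<lambda>v. (deriv ^^ Suc n) g (to_complex x) * to_complex v)) (at x)"
      unfolding has_field_derivative_def
      by (rule has_derivative_compose[OF bounded_linear_imp_has_derivative[OF bounded_linear_to_complex]])
    then show ?thesis
      by (auto intro!: derivative_eq_intros simp: mult_ac simp del: funpow.simps)
  qed
  moreover have "(\<lambda>x. Re ((a * to_complex v) * (deriv ^^ Suc n) g (to_complex x))) \<in> derivative_algebra w g" for v
    by (rule derivative_algebra.Re)
  ultimately show ?case
    by (intro exI[of _ "\<lambda>x v. Re ((a * to_complex v) * (deriv ^^ Suc n) g (to_complex x))"] conjI ballI allI)
       (assumption, rule bexI, rule ballI, rule refl, assumption)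
next
  case (const a)
  show ?case by (rule exI[of _ "\<lambda>x v. 0"]) (auto intro: derivative_algebra.const)
next
  case (add f h)
  then obtain D E where D: "\<forall>x\<in>S. (f has_derivative D x) (at x)" "\<forall>v. \<exists>h\<in>derivative_algebra w g. \<forall>x\<in>S. D x v = h x"
    and E: "\<forall>x\<in>S. (h has_derivative E x) (at x)" "\<forall>v. \<exists>h\<in>derivative_algebra w g. \<forall>x\<in>S. E x v = h x" by blast
  show ?case
  proof (intro exI[of _ "\<lambda>x v. D x v + E x v"] conjI ballI allI)
    show "((\<lambda>x. f x + h x) has_derivative (\<lambda>v. D x v + E x v)) (at x)" if "x \<in> S" for x
      using D(1) E(1) that by (intro has_derivative_add) auto
    fix v
    obtain d e where "d \<in> derivative_algebra w g" "\<forall>x\<in>S. D x v = d x" "e \<in> derivative_algebra w g" "\<forall>x\<in>S. E x v = e x"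
      using D(2) E(2) by meson
    then show "\<exists>h\<in>derivative_algebra w g. \<forall>x\<in>S. D x v + E x v = h x"
      by (intro bexI[of _ "\<lambda>x. d x + e x"] derivative_algebra.add) auto
  qed
next
  case (mult f h)
  then obtain D E where D: "\<forall>x\<in>S. (f has_derivative D x) (at x)" "\<forall>v. \<exists>h\<in>derivative_algebra w g. \<forall>x\<in>S. D x v = h x"
    and E: "\<forall>x\<in>S. (h has_derivative E x) (at x)" "\<forall>v. \<exists>h\<in>derivative_algebra w g. \<forall>x\<in>S. E x v = h x" by blast
  show ?case
  proof (intro exI[of _ "\<lambda>x v. f x * E x v + D x v * h x"] conjI ballI allI)
    show "((\<lambda>x. f x * h x) has_derivative (\<lambda>v. f x * E x v + D x v * h x)) (at x)" if "x \<in> S" for x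
      using D(1) E(1) that by (intro has_derivative_mult) auto
    fix v
    obtain d e where "d \<in> derivative_algebra w g" "\<forall>x\<in>S. D x v = d x" "e \<in> derivative_algebra w g" "\<forall>x\<in>S. E x v = e x"
      using D(2) E(2) by meson
    then show "\<exists>k\<in>derivative_algebra w g. \<forall>x\<in>S. f x * E x v + D x v * h x = k x"
      using mult.hyps
      by (intro bexI[of _ "\<lambda>x. f x * e x + d x * h x"] derivative_algebra.add derivative_algebra.mult) auto
  qed
qed

lemma smooth_on_sin_cos_ln:
  assumes "open S" "g holomorphic_on T" "open T" "\<And>x. x \<in> S \<Longrightarrow> to_complex x \<in> T"
    and "\<And>x. x \<in> S \<Longrightarrow> 0 < w x"
      "\<And>x. x \<in> S \<Longrightarrow> (w has_derivative (\<lambda>v. Re (- to_complex v * g (to_complex x)))) (at x)"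
  shows "smooth_on S (\<lambda>x. vector [sin (ln (w x)), cos (ln (w x))] :: real^2)"
proof (rule smooth_on_coinduct[OF \<open>open S\<close>])
  let ?A = "derivative_algebra w g"
  \<comment> \<open>The coinduction class: both components in the algebra, combined by basis vectors
    so that the derivative rules for sums and scalar multiples apply.\<close>
  define X :: "(real^2 \<Rightarrow> real^2) set" where "X = {\<lambda>x. f x *\<^sub>R axis 1 1 + h x *\<^sub>R axis 2 1 | f h. f \<in> ?A \<and> h \<in> ?A}"
  have "(\<lambda>x. vector [sin (ln (w x)), cos (ln (w x))] :: real^2)
    = (\<lambda>x. sin (ln (w x)) *\<^sub>R axis 1 1 + cos (ln (w x)) *\<^sub>R axis 2 1)"
    by (simp add: fun_eq_iff vec_eq_iff forall_2 axis_def)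
  then show "(\<lambda>x. vector [sin (ln (w x)), cos (ln (w x))] :: real^2) \<in> X"
    unfolding X_def
    by (intro CollectI exI[of _ "\<lambda>x. sin (ln (w x))"] exI[of _ "\<lambda>x. cos (ln (w x))"] conjI derivative_algebra.sin derivative_algebra.cos)
  fix F assume "F \<in> X"
  then obtain f h where F: "F = (\<lambda>x. f x *\<^sub>R axis 1 1 + h x *\<^sub>R axis 2 1)" and fh: "f \<in> ?A" "h \<in> ?A"
    unfolding X_def by blast
  have step: "\<exists>D. (\<forall>x\<in>S. (f has_derivative D x) (at x)) \<and> (\<forall>v. \<exists>h\<in>?A. \<forall>x\<in>S. D x v = h x)"
    if "f \<in> ?A" for f
    by (rule derivative_algebra_step[OF assms(2,3) _ _ _ that]; fact assms)
  obtain D E where D: "\<And>x. x \<in> S \<Longrightarrow> (f has_derivative D x) (at x)" "\<forall>v. \<exists>h\<in>?A. \<forall>x\<in>S. D x v = h x"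
    and E: "\<And>x. x \<in> S \<Longrightarrow> (h has_derivative E x) (at x)" "\<forall>v. \<exists>h\<in>?A. \<forall>x\<in>S. E x v = h x"
    using step[OF fh(1)] step[OF fh(2)] by blast
  show "\<exists>D. (\<forall>x\<in>S. (F has_derivative D x) (at x)) \<and> (\<forall>v. \<exists>g\<in>X. \<forall>x\<in>S. D x v = g x)"
  proof (intro exI[of _ "\<lambda>x v. D x v *\<^sub>R axis 1 1 + E x v *\<^sub>R axis 2 1"] conjI ballI allI)
    show "(F has_derivative (\<lambda>v. D x v *\<^sub>R axis 1 1 + E x v *\<^sub>R axis 2 1)) (at x)" if "x \<in> S" for x
      unfolding F using D(1)[OF that] E(1)[OF that]
      by (intro has_derivative_add has_derivative_scaleR_left)
    fix v
    obtain d e where de: "d \<in> ?A" "\<forall>x\<in>S. D x v = d x" "e \<in> ?A" "\<forall>x\<in>S. E x v = e x"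
      using D(2) E(2) by meson
    then have "(\<lambda>x. d x *\<^sub>R axis 1 1 + e x *\<^sub>R axis 2 1) \<in> X" unfolding X_def by blast
    then show "\<exists>g\<in>X. \<forall>x\<in>S. D x v *\<^sub>R axis 1 1 + E x v *\<^sub>R axis 2 1 = g x"
      by (rule rev_bexI) (use de in simp)
  qed
qed

context log_potential
begin

definition u :: "real^2 \<Rightarrow> real^2" where
  "u x = vector [sin (ln (w x)), cos (ln (w x))]"

lemma c_summable: "summable c"
  using summable_c c_le_sqrt by (intro summable_comparison_test'[OF summable_c, of 0]) simp

text \<open>Away from the closure all distances to the poles lie between a positive constant and
  \<open>2 * r\<close>, which bounds all kernels at once. The conclusion holds at every such point,
  not just almost everywhere.\<close>

lemma good_off_closure:
  assumes "x \<in> ball 0 r" "x \<notin> closure (range z)"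
  shows "good x"
proof -
  obtain d where d: "0 < d" "\<And>k. d \<le> dist (z k) x"
    using assms(2) unfolding closure_approachable by (metis not_le rangeI)
  have "norm (sqrt (c k) * log_kernel (dist (z k) x)) \<le> sqrt (c k) * (1 / (d\<^sup>2 * (- ln (2 * r) * sqrt (- ln (2 * r)))))" for k
  proof -
    have "log_kernel (dist (z k) x) \<le> 1 / (d\<^sup>2 * (- ln (2 * r) * sqrt (- ln (2 * r))))"
      using norm_diff_pole(1)[OF assms(1), of k] r
      by (intro log_kernel_antimono_bound d) (auto simp: dist_norm norm_minus_commute)
    then have "sqrt (c k) * log_kernel (dist (z k) x) \<le> sqrt (c k) * (1 / (d\<^sup>2 * (- ln (2 * r) * sqrt (- ln (2 * r)))))"
      by (rule mult_left_mono) simp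
    moreover have "0 \<le> sqrt (c k) * log_kernel (dist (z k) x)"
      using log_kernel_pole_nonneg[OF assms(1), of k] by simp
    ultimately show ?thesis unfolding real_norm_def by (simp only: abs_of_nonneg)
  qed
  then have "summable (\<lambda>k. sqrt (c k) * log_kernel (dist (z k) x))"
    by (intro summable_comparison_test'[OF summable_mult2[OF summable_c], of 0])
  then show ?thesis using assms closure_subset[of "range z"] by (auto simp: good_def)
qed

text \<open>Termwise differentiation on a small disc, where the gradients are dominated by
  \<open>c n / d\<close> and so converge uniformly. Only the first derivative is needed here;
  holomorphy takes over afterwards.\<close>

lemma w_has_derivative:
  assumes "x \<in> ball 0 r" "x \<notin> closure (range z)"
  shows "(w has_derivative (\<lambda>v. Dw x \<bullet> v)) (at x)"
proof -
  have "open (ball 0 r - closure (range z))" by (intro open_Diff) auto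
  \<comment> \<open>A disc of radius \<open>2 * d\<close> free of poles keeps every point of the
    disc of radius \<open>d\<close> at distance at least \<open>d\<close> from all poles.\<close>
  then obtain d where d: "0 < d" "ball x (2 * d) \<subseteq> ball 0 r - closure (range z)"
    using assms unfolding open_contains_ball by (metis DiffI field_sum_of_halves mult_2 half_gt_zero)
  have far: "d \<le> norm (y - z k)" if "y \<in> ball x d" for y k
  proof (rule ccontr)
    assume "\<not> d \<le> norm (y - z k)"
    then have "z k \<in> ball x (2 * d)"
      using that dist_triangle[of x "z k" y] by (simp add: dist_norm)
    then show False using d(2) closure_subset[of "range z"] by blast
  qed
  have good: "good y" if "y \<in> ball x d" for y
    using d that by (intro good_off_closure) (auto simp: subset_iff)
  have dL: "((\<lambda>y. c n * L n y) has_derivative (\<lambda>v. - (c n *\<^sub>R p n y) \<bullet> v)) (at y within ball x d)"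
    if "y \<in> ball x d" for n y
  proof -
    have y: "y - z n \<noteq> 0" using far[OF that, of n] d(1) by auto
    have "((\<lambda>y. norm (y - z n)) has_derivative (\<lambda>v. sgn (y - z n) \<bullet> v)) (at y)"
      by (rule has_derivative_compose[of "\<lambda>y. y - z n" "\<lambda>v. v" y UNIV norm "\<lambda>v. sgn (y - z n) \<bullet> v"])
         (use has_derivative_norm[OF y] in \<open>auto intro!: derivative_eq_intros simp: inner_commute\<close>)
    then have "((\<lambda>y. ln (norm (y - z n))) has_derivative (\<lambda>v. (sgn (y - z n) \<bullet> v) * (1 / norm (y - z n)))) (at y)"
      using y by (auto intro!: derivative_eq_intros simp: divide_inverse)
    then have "((\<lambda>y. c n * L n y) has_derivative (\<lambda>v. c n * - ((sgn (y - z n) \<bullet> v) * (1 / norm (y - z n))))) (at y)"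
      unfolding L_def by (intro has_derivative_mult_right has_derivative_minus)
    moreover have "c n * - ((sgn (y - z n) \<bullet> v) * (1 / norm (y - z n))) = - (c n *\<^sub>R p n y) \<bullet> v" for v
      by (simp add: p_def sgn_div_norm power2_eq_square inverse_eq_divide)
    ultimately show ?thesis by (simp add: has_derivative_at_withinI)
  qed
  have "uniform_limit (ball x d) (\<lambda>n y. \<Sum>i<n. c i *\<^sub>R p i y) (\<lambda>y. \<Sum>i. c i *\<^sub>R p i y) sequentially"
  proof (rule Weierstrass_m_test)
    show "norm (c n *\<^sub>R p n y) \<le> c n * (1 / d)" if "y \<in> ball x d" for n y
      using far[OF that, of n] d(1) by (simp add: norm_p frac_le)
    show "summable (\<lambda>n. c n * (1 / d))" using c_summable by (rule summable_mult2)
  qed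
  then have unif: "\<forall>\<^sub>F n in sequentially. \<forall>y\<in>ball x d. norm ((\<Sum>i<n. c i *\<^sub>R p i y) - (\<Sum>i. c i *\<^sub>R p i y)) < e"
    if "0 < e" for e using that unfolding uniform_limit_iff dist_norm by blast
  have "\<exists>f. \<forall>y\<in>ball x d. (\<lambda>n. c n * L n y) sums f y \<and> (f has_derivative (\<lambda>v. Dw y \<bullet> v)) (at y within ball x d)"
  proof (rule has_derivative_series[OF convex_ball dL])
    show "\<forall>\<^sub>F n in sequentially. \<forall>y\<in>ball x d. \<forall>h. norm ((\<Sum>i<n. - (c i *\<^sub>R p i y) \<bullet> h) - Dw y \<bullet> h) \<le> e * norm h"
      if "0 < e" for e
      using unif[OF that]
    proof eventually_elim
      case (elim n)
      show ?case
      proof (intro ballI allI)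
        fix y h assume y: "y \<in> ball x d"
        have "(\<Sum>i<n. - (c i *\<^sub>R p i y) \<bullet> h) - Dw y \<bullet> h = - (((\<Sum>i<n. c i *\<^sub>R p i y) - (\<Sum>i. c i *\<^sub>R p i y)) \<bullet> h)"
          by (simp add: Dw_def inner_diff_left inner_sum_left sum_negf)
        then have "norm ((\<Sum>i<n. - (c i *\<^sub>R p i y) \<bullet> h) - Dw y \<bullet> h) \<le> norm ((\<Sum>i<n. c i *\<^sub>R p i y) - (\<Sum>i. c i *\<^sub>R p i y)) * norm h"
          using Cauchy_Schwarz_ineq2 by simp
        also have "\<dots> \<le> e * norm h" using less_imp_le[OF elim[rule_format, OF y]] by (rule mult_right_mono) simp
        finally show "norm ((\<Sum>i<n. - (c i *\<^sub>R p i y) \<bullet> h) - Dw y \<bullet> h) \<le> e * norm h" .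
      qed
    qed
    show "x \<in> ball x d" using d by simp
    then show "(\<lambda>n. c n * L n x) sums w x"
      unfolding w_def using good_summable(1)[OF good] by (intro summable_sums)
  qed
  then obtain f where f: "\<And>y. y \<in> ball x d \<Longrightarrow> (\<lambda>n. c n * L n y) sums f y"
    "\<And>y. y \<in> ball x d \<Longrightarrow> (f has_derivative (\<lambda>v. Dw y \<bullet> v)) (at y within ball x d)" by blast
  have x: "x \<in> ball x d" using d by simp
  have "(f has_derivative (\<lambda>v. Dw x \<bullet> v)) (at x)"
    using f(2)[OF x] at_within_open[OF x open_ball] by simp
  moreover have "f y = w y" if "y \<in> ball x d" for y
    using f(1)[OF that] by (simp add: w_def sums_iff)
  ultimately show ?thesis
    by (rule has_derivative_transform_within_open[OF _ open_ball x])
qed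

text \<open>The derivative of \<open>w\<close> is minus the real part of the direction times the
  Cauchy transform \<open>g\<close> with terms \<open>c n / (\<zeta> - z n)\<close>. Locally uniform
  convergence makes \<open>g\<close> holomorphic off the closure of the poles.\<close>

lemma smooth_on_u: "smooth_on (ball 0 r - closure (range z)) u"
proof -
  define T where "T = - closure (range (\<lambda>k. to_complex (z k)))"
  have "open T" unfolding T_def by (intro open_Compl closed_closure)
  have far: "\<exists>d>0. \<forall>k. d \<le> cmod (\<zeta> - to_complex (z k))" if \<zeta>: "\<zeta> \<in> T" for \<zeta>
  proof -
    obtain d where "0 < d" "\<And>k. d \<le> dist (to_complex (z k)) \<zeta>"
      using \<zeta> unfolding T_def Compl_iff closure_approachable by (metis not_le rangeI)
    then show ?thesis by (auto simp: dist_norm norm_minus_commute)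
  qed
  obtain g where g: "\<forall>\<zeta>\<in>T. ((\<lambda>n. of_real (c n) / (\<zeta> - to_complex (z n))) sums g \<zeta>) \<and> g field_differentiable (at \<zeta>)"
  proof (rule series_differentiable_comparison_complex[OF \<open>open T\<close>])
    fix n \<zeta> assume "\<zeta> \<in> T"
    then obtain d where "0 < d" "d \<le> cmod (\<zeta> - to_complex (z n))" using far by blast
    then have "\<zeta> - to_complex (z n) \<noteq> 0" by auto
    then show "(\<lambda>\<zeta>. of_real (c n) / (\<zeta> - to_complex (z n))) field_differentiable (at \<zeta>)"
      by (auto intro!: derivative_intros)
  next
    fix \<zeta> assume "\<zeta> \<in> T"
    then obtain d where d: "0 < d" "\<And>k. d \<le> cmod (\<zeta> - to_complex (z k))" using far by blast
    have "cmod (of_real (c n) / (y - to_complex (z n))) \<le> cmod (of_real (c n * (2 / d)))" if "y \<in> ball \<zeta> (d / 2)" for y n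
    proof -
      have "d / 2 \<le> cmod (y - to_complex (z n))"
        using that d(2)[of n] norm_triangle_ineq[of "\<zeta> - y" "y - to_complex (z n)"] by (simp add: dist_norm)
      then have "c n / cmod (y - to_complex (z n)) \<le> c n / (d / 2)"
        using d(1) by (intro divide_left_mono mult_pos_pos) auto
      then show ?thesis using d(1) by (simp add: norm_divide norm_mult)
    qed
    moreover have "summable (\<lambda>n. complex_of_real (c n * (2 / d)))"
      using c_summable by (intro summable_of_real summable_mult2)
    moreover have "range (\<lambda>n. complex_of_real (c n * (2 / d))) \<subseteq> \<real>\<^sub>\<ge>\<^sub>0"
      using d(1) by (auto simp: nonneg_Reals_of_real_iff simp del: of_real_mult of_real_divide)
    ultimately show "\<exists>d h. 0 < d \<and> summable h \<and> range h \<subseteq> \<real>\<^sub>\<ge>\<^sub>0 \<and> (\<forall>\<^sub>F n in sequentially. \<forall>y\<in>ball \<zeta> d \<inter> T.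
        cmod (of_real (c n) / (y - to_complex (z n))) \<le> cmod (h n))"
      using d(1) by (intro exI[of _ "d / 2"] exI[of _ "\<lambda>n. complex_of_real (c n * (2 / d))"] conjI always_eventually) auto
  qed
  have "g holomorphic_on T"
    using g \<open>open T\<close> by (auto simp: holomorphic_on_def intro: field_differentiable_at_within)
  let ?S = "ball 0 r - closure (range z)"
  have to_T: "to_complex x \<in> T" if "x \<notin> closure (range z)" for x
    using that unfolding T_def Compl_iff closure_approachable
    by (auto simp: dist_norm norm_to_complex simp flip: to_complex_diff)
  have "open ?S" by (intro open_Diff) auto
  have "smooth_on ?S (\<lambda>x. vector [sin (ln (w x)), cos (ln (w x))] :: real^2)"
  proof (rule smooth_on_sin_cos_ln[OF \<open>open ?S\<close> \<open>g holomorphic_on T\<close> \<open>open T\<close>])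
    fix x assume x: "x \<in> ?S"
    then show "to_complex x \<in> T" using to_T by blast
    have good: "good x" using x by (intro good_off_closure) auto
    then show "0 < w x" using good_bounds(2) wmin_pos by (auto intro: less_le_trans)
    have "Dw x \<bullet> v = Re (- to_complex v * g (to_complex x))" for v
    proof -
      have "(\<lambda>n. Re (- to_complex v * (of_real (c n) / (to_complex x - to_complex (z n))))) sums Re (- to_complex v * g (to_complex x))"
        using g \<open>to_complex x \<in> T\<close> by (intro sums_Re sums_mult) blast
      moreover have "Re (- to_complex v * (of_real (c n) / (to_complex x - to_complex (z n)))) = - ((c n *\<^sub>R p n x) \<bullet> v)" for n
      proof -
        have "p n x \<bullet> v = Re (to_complex v / to_complex (x - z n))"
          unfolding p_def by (rule inner_scaled_eq_Re_divide) (use goodD(2)[OF good] in simp)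
        moreover have "- to_complex v * (of_real (c n) / (to_complex x - to_complex (z n)))
            = c n *\<^sub>R - (to_complex v / to_complex (x - z n))"
          by (simp add: to_complex_diff scaleR_conv_of_real)
        ultimately show ?thesis by (simp only: scaleR_complex.sel uminus_complex.sel inner_scaleR_left mult_minus_right)
      qed
      moreover have "(\<lambda>n. - ((c n *\<^sub>R p n x) \<bullet> v)) sums (Dw x \<bullet> v)"
        unfolding Dw_def inner_minus_left
        by (intro sums_minus bounded_linear.sums[OF bounded_linear_inner_left] summable_sums good_summable(2)[OF good])
      ultimately show ?thesis using sums_unique2 by simp
    qed
    then show "(w has_derivative (\<lambda>v. Re (- to_complex v * g (to_complex x)))) (at x)"
      using w_has_derivative[of x] x by simp
  qed
  then show ?thesis unfolding u_def[abs_def] .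
qed

end

subsection \<open>Discontinuity at the poles\<close>

text \<open>The radius \<open>exp (- ((1/2) ^ j) / c j)\<close> is where \<open>c j * ln (1 / norm (x - z j))\<close> drops below
  \<open>(1/2) ^ j\<close>. The sequence of poles may repeat, because a finite set of poles is enumerated with repetitions.\<close>

lemma exists_small_coefficients:
  fixes z :: "nat \<Rightarrow> 'a::real_normed_vector"
  obtains c :: "nat \<Rightarrow> real" where "\<And>j. 0 < c j" "\<And>j. c j \<le> (1/4) ^ j"
    "\<And>j k. k < j \<Longrightarrow> z k \<noteq> z j \<Longrightarrow> exp (- ((1/2) ^ j) / c j) \<le> (1/2) ^ (j + 3) * norm (z j - z k)"
proof -
  have "\<exists>c>0. c \<le> (1/4) ^ j \<and> (\<forall>k<j. z k \<noteq> z j \<longrightarrow> exp (- ((1/2) ^ j) / c) \<le> (1/2) ^ (j + 3) * norm (z j - z k))" for j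
  proof -
    define D where "D = insert 1 ((\<lambda>k. (1/2) ^ (j + 3) * norm (z j - z k)) ` {k. k < j \<and> z k \<noteq> z j})"
    define d where "d = Min D"
    have D: "finite D" "D \<noteq> {}" by (simp_all add: D_def)
    then have d: "0 < d" unfolding d_def by (subst Min_gr_iff) (auto simp: D_def)
    \<comment> \<open>With this choice \<open>(1/2) ^ j / c\<close> equals
      \<open>2 ^ j * (1 + \<bar>ln d\<bar>)\<close>, which is at least \<open>- ln d\<close>; so the
      radius in question is at most \<open>d\<close>.\<close>
    define c where "c = (1/4) ^ j / (1 + \<bar>ln d\<bar>)"
    have pos: "0 < 1 + \<bar>ln d\<bar>" by simp
    show ?thesis
    proof (intro exI[of _ c] conjI allI impI)
      show "0 < c" using pos by (simp add: c_def)
      show "c \<le> (1/4) ^ j" using pos by (simp add: c_def pos_divide_le_eq)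
      have "(1/2 :: real) ^ j / c = 2 ^ j * (1 + \<bar>ln d\<bar>)"
        using pos by (simp add: c_def field_simps flip: power_mult_distrib)
      moreover have "1 * (1 + \<bar>ln d\<bar>) \<le> 2 ^ j * (1 + \<bar>ln d\<bar>)" using pos by (intro mult_right_mono) auto
      ultimately have "1 + \<bar>ln d\<bar> \<le> (1/2) ^ j / c" by (simp only: mult_1)
      then have "- ((1/2) ^ j) / c \<le> ln d"
        using abs_ge_minus_self[of "ln d"] unfolding minus_divide_left[symmetric] by linarith
      then have "exp (- ((1/2) ^ j) / c) \<le> d" 
        unfolding exp_le_cancel_iff[symmetric, of _ "ln d"] exp_ln[OF d] .
      moreover fix k assume "k < j" "z k \<noteq> z j"
      then have "d \<le> (1/2) ^ (j + 3) * norm (z j - z k)" unfolding d_def using D by (intro Min_le) (auto simp: D_def)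
      ultimately show "exp (- ((1/2) ^ j) / c) \<le> (1/2) ^ (j + 3) * norm (z j - z k)" by simp
    qed
  qed
  then show ?thesis using that by metis
qed

lemma emeasure_lebesgue_ball_2:
  assumes "0 \<le> s"
  shows "emeasure lebesgue (ball (a :: real^2) s) = ennreal (s\<^sup>2 * pi)"
  using circle_area[OF assms, of a] emeasure_eq_ennreal_measure[of lborel "ball a s"]
    emeasure_lborel_ball_finite[of a s] by simp

lemma cos_ge_half: "1 / 2 \<le> cos \<delta>" if "0 \<le> \<delta>" "\<delta> \<le> 1" for \<delta> :: real
proof -
  have "\<delta> \<le> pi / 3" using that pi_gt3 by simp
  then have "cos (pi / 3) \<le> cos \<delta>" using that pi_gt3 by (intro cos_monotone_0_pi_le) auto
  then show ?thesis by (simp add: cos_60)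
qed

context log_potential
begin

text \<open>An area count. An exceptional disc of a later pole that meets
  \<open>ball (z k) \<rho>\<close> has radius at most \<open>(1/2) ^ j * \<rho> / 4\<close>. All
  such discs together have area at most 1/12 of that of \<open>ball (z k) \<rho>\<close>, whereas
  the annulus takes up 3/4, so a set of positive measure is left and meets \<open>P\<close>.\<close>

lemma annulus_not_covered:
  assumes sep: "\<And>j k. k < j \<Longrightarrow> z k \<noteq> z j \<Longrightarrow> exp (- ((1/2) ^ j) / c j) \<le> (1/2) ^ (j + 3) * norm (z j - z k)"
    and P: "AE x in lebesgue_on (ball 0 r). P x"
    and \<rho>: "0 < \<rho>" "ball (z k) \<rho> \<subseteq> ball 0 r"
  obtains x where "P x" "\<rho> / 2 \<le> norm (x - z k)" "norm (x - z k) < \<rho>"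
    "\<And>j. k < j \<Longrightarrow> z k \<noteq> z j \<Longrightarrow> exp (- ((1/2) ^ j) / c j) \<le> norm (x - z j)"
proof -
  define R where "R = (\<lambda>j. exp (- ((1/2) ^ j) / c j))"
  \<comment> \<open>Distant exceptional discs are replaced by the empty set: only for those that
    meet the disc does separation bound the radius in terms of \<rho>.\<close>
  define F where "F = (\<lambda>j. if k < j \<and> z k \<noteq> z j \<and> ball (z j) (R j) \<inter> ball (z k) \<rho> \<noteq> {} then ball (z j) (R j) else {})"
  let ?A = "ball (z k) \<rho> - ball (z k) (\<rho> / 2)"
  have "\<exists>x\<in>?A. P x \<and> x \<notin> (\<Union>j. F j)"
  proof (rule ccontr)
    assume neg: "\<not> (\<exists>x\<in>?A. P x \<and> x \<notin> (\<Union>j. F j))"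
    have "AE x in lebesgue. x \<in> ball 0 r \<longrightarrow> P x"
      using P by (simp add: AE_restrict_space_iff)
    then have ae: "AE x in lebesgue. x \<in> ?A \<longrightarrow> x \<in> (\<Union>j. F j)"
      by eventually_elim (use neg \<rho>(2) in blast)
    have F: "F j \<in> sets lebesgue" for j by (simp add: F_def)
    have "emeasure lebesgue ?A = ennreal (\<rho>\<^sup>2 * pi) - ennreal ((\<rho> / 2)\<^sup>2 * pi)"
      using \<rho>(1) by (subst emeasure_Diff) (auto simp: emeasure_lebesgue_ball_2 simp del: emeasure_completion intro: subset_ball)
    also have "\<dots> = ennreal (3 / 4 * (\<rho>\<^sup>2 * pi))"
      by (subst ennreal_minus) (simp_all add: power_divide field_simps)
    finally have A: "emeasure lebesgue ?A = ennreal (3 / 4 * (\<rho>\<^sup>2 * pi))" .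
    have Fle: "emeasure lebesgue (F j) \<le> ennreal (\<rho>\<^sup>2 * pi / 16 * (1/4) ^ j)" for j
    proof (cases "k < j \<and> z k \<noteq> z j \<and> ball (z j) (R j) \<inter> ball (z k) \<rho> \<noteq> {}")
      case True
      then obtain y where y: "norm (y - z j) < R j" "norm (y - z k) < \<rho>"
        by (auto simp: dist_norm norm_minus_commute)
      define n where "n = norm (z j - z k)"
      have Rn: "R j \<le> (1/2) ^ (j + 3) * n" using sep[of k j] True by (simp add: R_def n_def)
      \<comment> \<open>As the exceptional radius is at most half of \<open>n\<close>, the triangle
        inequality \<open>n \<le> n / 2 + \<rho>\<close> yields
        \<open>n \<le> 2 * \<rho>\<close>.\<close>
      have "(1/2 :: real) ^ (j + 3) \<le> (1/2) ^ 1" by (intro power_decreasing) auto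
      then have "(1/2) ^ (j + 3) * n \<le> (1/2) ^ 1 * n" by (intro mult_right_mono) (auto simp: n_def)
      moreover have "n \<le> norm (y - z j) + norm (y - z k)"
        unfolding n_def using norm_triangle_ineq4[of "y - z k" "y - z j"] by (simp add: algebra_simps)
      ultimately have n: "n \<le> 2 * \<rho>" using Rn y by simp
      then have "(1/2) ^ (j + 3) * n \<le> (1/2) ^ (j + 3) * (2 * \<rho>)" by (intro mult_left_mono) auto
      also have "\<dots> = (1/2) ^ j * (\<rho> / 4)" by (simp add: power_add power3_eq_cube)
      finally have "R j \<le> (1/2) ^ j * (\<rho> / 4)" using Rn by linarith
      then have "(R j)\<^sup>2 \<le> ((1/2) ^ j * (\<rho> / 4))\<^sup>2" by (intro power_mono) (auto simp: R_def)
      also have "\<dots> = \<rho>\<^sup>2 / 16 * (1/4) ^ j"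
        by (simp add: power_mult_distrib power_divide power2_eq_square flip: power_mult_distrib)
      finally have "(R j)\<^sup>2 * pi \<le> \<rho>\<^sup>2 / 16 * (1/4) ^ j * pi" by (intro mult_right_mono) auto
      then have "ennreal ((R j)\<^sup>2 * pi) \<le> ennreal (\<rho>\<^sup>2 * pi / 16 * (1/4) ^ j)" by (intro ennreal_leI) (simp add: mult_ac)
      moreover have "F j = ball (z j) (R j)" using True by (simp add: F_def)
      moreover have "0 \<le> R j" by (simp add: R_def)
      ultimately show ?thesis by (simp add: emeasure_lebesgue_ball_2 del: emeasure_completion)
    next
      case False
      then have "F j = {}" unfolding F_def by (rule if_not_P)
      then show ?thesis by simp
    qed
    have "emeasure lebesgue ?A \<le> emeasure lebesgue (\<Union>j. F j)"
      using ae F by (intro emeasure_mono_AE) auto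
    also have "\<dots> \<le> (\<Sum>j. emeasure lebesgue (F j))" using F by (intro emeasure_subadditive_countably) auto
    also have "\<dots> \<le> (\<Sum>j. ennreal (\<rho>\<^sup>2 * pi / 16 * (1/4) ^ j))" using Fle by (intro suminf_le summableI allI)
    also have "\<dots> = ennreal (\<Sum>j. \<rho>\<^sup>2 * pi / 16 * (1/4) ^ j)"
      by (intro suminf_ennreal2 summable_mult summable_geometric) auto
    also have "(\<Sum>j. \<rho>\<^sup>2 * pi / 16 * (1/4) ^ j) = \<rho>\<^sup>2 * pi / 16 * (4 / 3)"
      by (subst suminf_mult) (auto simp: suminf_geometric summable_geometric)
    finally have "3 / 4 * (\<rho>\<^sup>2 * pi) \<le> \<rho>\<^sup>2 * pi / 16 * (4 / 3)" unfolding A by (subst (asm) ennreal_le_iff) auto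
    moreover have "0 < \<rho>\<^sup>2 * pi" using \<rho> by simp
    ultimately show False by linarith
  qed
  then obtain x where x: "x \<in> ?A" "P x" "\<And>j. x \<notin> F j" by blast
  have "R j \<le> norm (x - z j)" if "k < j" "z k \<noteq> z j" for j
  proof (rule ccontr)
    assume "\<not> R j \<le> norm (x - z j)"
    then have "x \<in> ball (z j) (R j)" by (simp add: dist_norm norm_minus_commute)
    with x(1) that have "x \<in> F j" by (auto simp: F_def)
    with x(3) show False by blast
  qed
  with x(1,2) show ?thesis by (intro that[of x]) (auto simp: R_def dist_norm norm_minus_commute)
qed

text \<open>The series splits by index. Repetitions of \<open>z k\<close> give the main term;
  earlier poles elsewhere stay at a fixed distance; later ones contribute at most
  \<open>(1/2) ^ j\<close> each outside their exceptional discs. The error \<open>M\<close> also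
  contains \<open>ln 2\<close>, since the point lies between radius \<open>\<rho> / 2\<close> and
  \<rho>.\<close>

lemma w_near_pole:
  assumes sep: "\<And>j k. k < j \<Longrightarrow> z k \<noteq> z j \<Longrightarrow> exp (- ((1/2) ^ j) / c j) \<le> (1/2) ^ (j + 3) * norm (z j - z k)"
    and P: "AE x in lebesgue_on (ball 0 r). P x"
  obtains C M \<rho>\<^sub>0 where "0 < C" "0 \<le> M" "0 < \<rho>\<^sub>0"
    "\<And>\<rho>. 0 < \<rho> \<Longrightarrow> \<rho> < \<rho>\<^sub>0 \<Longrightarrow> \<exists>x. x \<in> ball 0 r \<and> norm (x - z k) < \<rho> \<and> P x \<and>
        C * - ln \<rho> \<le> w x \<and> w x \<le> C * - ln \<rho> + M"
proof -
  \<comment> \<open>\<open>a\<close> collects the coefficients of all repetitions of the pole, so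
    that its sum is \<open>C\<close>; \<open>m\<close> majorises the remaining terms.\<close>
  define a where "a = (\<lambda>j. if z j = z k then c j else 0)"
  define m where "m = (\<lambda>j. if z j = z k then 0 else if j \<le> k then c j * - ln (norm (z j - z k) / 2) else (1/2) ^ j)"
  \<comment> \<open>Radii below \<open>Min D\<close> keep the disc inside the ball and within half
    the distance to each earlier pole elsewhere.\<close>
  define D where "D = insert (r - norm (z k)) ((\<lambda>j. norm (z j - z k) / 2) ` {j. j \<le> k \<and> z j \<noteq> z k})"
  have a: "summable a"
    by (rule summable_comparison_test'[OF c_summable, of 0]) (simp add: a_def)
  have "summable (\<lambda>j. (1/2 :: real) ^ j)" by (rule summable_geometric) simp
  then have m: "summable m"
    by (rule summable_comparison_test'[of _ "Suc k"]) (simp add: m_def)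
  show ?thesis
  proof
    show "0 < suminf a"
      by (rule suminf_pos2[OF a, of k]) (use c in \<open>auto simp: a_def\<close>)
    show "0 \<le> \<bar>suminf a * ln 2 + suminf m\<bar>" by simp
    have D: "finite D" "D \<noteq> {}" by (simp_all add: D_def)
    have zk: "norm (z k) < r" using z[of k] by simp
    then show "0 < Min D" using D by (subst Min_gr_iff) (auto simp: D_def)
    fix \<rho> assume \<rho>: "0 < \<rho>" "\<rho> < Min D"
    have "\<rho> < r - norm (z k)" using \<rho>(2) D by (subst (asm) Min_gr_iff) (auto simp: D_def)
    then have sub: "ball (z k) \<rho> \<subseteq> ball 0 r"
      by (auto simp: dist_norm subset_iff) (smt (verit) norm_minus_commute norm_triangle_sub)
    have far: "\<rho> < norm (z j - z k) / 2" if "j \<le> k" "z j \<noteq> z k" for j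
      using \<rho>(2) D that by (subst (asm) Min_gr_iff) (auto simp: D_def)
    have "AE x in lebesgue_on (ball 0 r). P x \<and> good x" using P AE_good by eventually_elim simp
    from annulus_not_covered[OF sep this \<rho>(1) sub]
    obtain x where x: "P x" "good x" "\<rho> / 2 \<le> norm (x - z k)" "norm (x - z k) < \<rho>"
      and out: "\<And>j. k < j \<Longrightarrow> z k \<noteq> z j \<Longrightarrow> exp (- ((1/2) ^ j) / c j) \<le> norm (x - z j)" by auto
    have xz: "0 < norm (x - z j)" for j using goodD(2)[OF x(2)] by simp
    have "a j * - ln \<rho> \<le> c j * L j x \<and> c j * L j x \<le> a j * (- ln \<rho> + ln 2) + m j" for j
    proof (cases "z j = z k")
      case True
      have A: "- ln \<rho> \<le> L j x" using x(4) xz[of k] \<rho>(1) True by (simp add: L_def)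
      have "ln (\<rho> / 2) \<le> ln (norm (x - z k))" using x(3) \<rho>(1) xz[of k] by (subst ln_le_cancel_iff) auto
      then have B: "L j x \<le> - ln \<rho> + ln 2" using \<rho>(1) True by (simp add: L_def ln_div)
      show ?thesis
        using mult_left_mono[OF A c_nonneg[of j]] mult_left_mono[OF B c_nonneg[of j]] True
        unfolding a_def m_def by (simp only: if_True add_0_right simp_thms)
    next
      case False
      have "c j * L j x \<le> m j"
      proof (cases "j \<le> k")
        case True
        have "norm (z j - z k) \<le> norm (x - z j) + norm (x - z k)"
          using norm_triangle_ineq4[of "x - z k" "x - z j"] by (simp add: algebra_simps)
        then have "norm (z j - z k) / 2 \<le> norm (x - z j)" using far[OF True False] x(4) by simp
        then have "L j x \<le> - ln (norm (z j - z k) / 2)"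
          unfolding L_def using False xz[of j] by (subst neg_le_iff_le, subst ln_le_cancel_iff) auto
        then have "c j * L j x \<le> c j * - ln (norm (z j - z k) / 2)"
          by (rule mult_left_mono) simp
        then show ?thesis using True False by (simp only: m_def if_True if_False simp_thms)
      next
        case jk: False
        have "ln (exp (- ((1/2) ^ j) / c j)) \<le> ln (norm (x - z j))"
          using out[of j] jk False xz[of j] by (subst ln_le_cancel_iff) auto
        then have "L j x \<le> (1/2) ^ j / c j" by (simp add: L_def)
        then show ?thesis using c(1)[of j] jk False by (simp add: m_def pos_le_divide_eq mult.commute)
      qed
      moreover have "0 \<le> c j * L j x" using L_ge(2)[OF goodD(1,2)[OF x(2)], of j] by simp
      ultimately show ?thesis using False by (simp add: a_def)
    qed
    then have lo: "a j * - ln \<rho> \<le> c j * L j x" and hi: "c j * L j x \<le> a j * (- ln \<rho> + ln 2) + m j" for j by auto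
    have "suminf a * - ln \<rho> = (\<Sum>j. a j * - ln \<rho>)" by (rule suminf_mult2[OF a])
    also have "\<dots> \<le> w x" unfolding w_def
      by (rule suminf_le[OF lo summable_mult2[OF a] good_summable(1)[OF x(2)]])
    finally have lower: "suminf a * - ln \<rho> \<le> w x" .
    have "w x \<le> (\<Sum>j. a j * (- ln \<rho> + ln 2) + m j)" unfolding w_def
      by (rule suminf_le[OF hi good_summable(1)[OF x(2)] summable_add[OF summable_mult2[OF a] m]])
    also have "\<dots> = suminf a * (- ln \<rho> + ln 2) + suminf m"
      by (simp only: suminf_mult2[OF a] suminf_add[OF summable_mult2[OF a] m])
    finally have upper: "w x \<le> suminf a * - ln \<rho> + \<bar>suminf a * ln 2 + suminf m\<bar>"
      unfolding distrib_left by linarith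
    show "\<exists>x. x \<in> ball 0 r \<and> norm (x - z k) < \<rho> \<and> P x \<and>
        suminf a * - ln \<rho> \<le> w x \<and> w x \<le> suminf a * - ln \<rho> + \<bar>suminf a * ln 2 + suminf m\<bar>"
      using lower upper x goodD(1)[OF x(2)] by blast
  qed
qed

text \<open>A version continuous at the point would confine \<open>u\<close> almost everywhere
  nearby to a ball of radius 1/2. Near a pole, however, \<open>cos (ln w)\<close> is at least 1/2 at
  some of the admissible points and at most -1/2 at others. The point itself need not be a pole, so
  a pole close to it is used.\<close>

lemma essentially_discontinuous_at_pole_closure:
  assumes sep: "\<And>j k. k < j \<Longrightarrow> z k \<noteq> z j \<Longrightarrow> exp (- ((1/2) ^ j) / c j) \<le> (1/2) ^ (j + 3) * norm (z j - z k)"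
    and x\<^sub>0: "x\<^sub>0 \<in> closure (range z)"
  shows "essentially_discontinuous_at (ball 0 r) u x\<^sub>0"
  unfolding essentially_discontinuous_at_def
proof (intro allI impI notI)
  fix v assume v: "AE x in lebesgue_on (ball 0 r). v x = u x" and "continuous (at x\<^sub>0 within ball 0 r) v"
  then obtain d where d: "0 < d" "\<And>x. x \<in> ball 0 r \<Longrightarrow> dist x x\<^sub>0 < d \<Longrightarrow> dist (v x) (v x\<^sub>0) < 1 / 2"
    unfolding continuous_within_eps_delta by (meson zero_less_divide_1_iff zero_less_numeral)
  obtain k where k: "dist (z k) x\<^sub>0 < d / 2"
    using x\<^sub>0 d(1) unfolding closure_approachable by (metis half_gt_zero rangeE)
  obtain C M \<rho>\<^sub>0 where C: "0 < C" "0 \<le> M" "0 < \<rho>\<^sub>0"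
    and near: "\<And>\<rho>. 0 < \<rho> \<Longrightarrow> \<rho> < \<rho>\<^sub>0 \<Longrightarrow> \<exists>x. x \<in> ball 0 r \<and> norm (x - z k) < \<rho> \<and> v x = u x \<and>
        C * - ln \<rho> \<le> w x \<and> w x \<le> C * - ln \<rho> + M"
    using w_near_pole[OF sep v, of k] by metis
  have phase: "\<exists>x \<delta>. dist (u x) (v x\<^sub>0) < 1 / 2 \<and> 0 \<le> \<delta> \<and> \<delta> \<le> 1 \<and> cos (ln (w x)) = cos (\<sigma> + \<delta>)"
    if "0 \<le> \<sigma>" for \<sigma>
  proof -
    define \<epsilon> where "\<epsilon> = min \<rho>\<^sub>0 (d / 2)"
    have \<epsilon>: "0 < \<epsilon>" using C d by (simp add: \<epsilon>_def)
    \<comment> \<open>A large \<open>n\<close> makes \<open>T\<close> exceed \<open>M\<close>, so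
      that the error at most doubles \<open>w\<close> and moves the phase by at most 1. It also
      makes the radius at which the main term equals \<open>T\<close> smaller than
      \<epsilon>.\<close>
    obtain n :: nat where n: "max M (C * - ln \<epsilon>) < n" using reals_Archimedean2 by blast
    define T where "T = exp (\<sigma> + 2 * pi * n)"
    have "real n \<le> 2 * pi * n" using pi_gt3 by (simp add: mult_le_cancel_right1)
    then have "real n < T"
      using that exp_ge_add_one_self[of "\<sigma> + 2 * pi * n"] unfolding T_def by linarith
    then have T: "M < T" "C * - ln \<epsilon> < T" "0 < T"
      using n C by auto
    \<comment> \<open>The radius at which the main term \<open>C * - ln \<rho>\<close> takes the
      value \<open>T\<close>, whose phase is \<sigma> modulo \<open>2 * pi\<close>.\<close>
    define \<rho> where "\<rho> = exp (- T / C)"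
    have "- T / C < ln \<epsilon>" using T(2) C(1) by (simp add: field_simps)
    then have "\<rho> < \<epsilon>" unfolding \<rho>_def using \<epsilon> by (metis exp_less_mono exp_ln)
    then have \<rho>: "0 < \<rho>" "\<rho> < \<rho>\<^sub>0" "\<rho> < d / 2" by (auto simp: \<rho>_def \<epsilon>_def)
    have "C * - ln \<rho> = T" using C by (simp add: \<rho>_def)
    then obtain x where x: "x \<in> ball 0 r" "norm (x - z k) < \<rho>" "v x = u x" "T \<le> w x" "w x \<le> T + M"
      using near[OF \<rho>(1,2)] by auto
    have "dist x x\<^sub>0 < d" using dist_triangle[of x x\<^sub>0 "z k"] x(2) k \<rho>(3) by (simp add: dist_norm)
    then have "dist (u x) (v x\<^sub>0) < 1 / 2" using d(2)[OF x(1)] x(3) by simp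
    moreover define \<delta> where "\<delta> = ln (w x / T)"
    have wT: "1 \<le> w x / T" "w x / T \<le> 2" using x(4,5) T by (simp_all add: field_simps)
    then have "0 \<le> \<delta>" "\<delta> \<le> 1" using ln_le_minus_one[of "w x / T"] by (simp_all add: \<delta>_def)
    moreover have "ln (w x) = \<sigma> + \<delta> + 2 * pi * n"
    proof -
      have "ln (w x / T) = ln (w x) - ln T"
        using order.strict_trans2[OF T(3) x(4)] T(3) by (simp add: ln_div)
      then show ?thesis by (simp add: \<delta>_def T_def)
    qed
    then have "cos (ln (w x)) = cos (\<sigma> + \<delta>)"
      using cos.plus_of_nat[of "\<sigma> + \<delta>" n] by (simp add: mult_ac)
    ultimately show ?thesis by blast
  qed
  \<comment> \<open>Opposite phases 0 and \<open>pi\<close>: as 1 < \<open>pi / 3\<close>, a shift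
    of at most 1 keeps the two cosines beyond 1/2 and -1/2.\<close>
  obtain x \<delta> where x: "dist (u x) (v x\<^sub>0) < 1 / 2" "0 \<le> \<delta>" "\<delta> \<le> 1" "cos (ln (w x)) = cos (0 + \<delta>)"
    using phase[of 0] by auto
  obtain y \<eta> where y: "dist (u y) (v x\<^sub>0) < 1 / 2" "0 \<le> \<eta>" "\<eta> \<le> 1" "cos (ln (w y)) = cos (pi + \<eta>)"
    using phase[of pi] by auto
  have "1 \<le> u x $ 2 - u y $ 2"
    using cos_ge_half[OF x(2,3)] cos_ge_half[OF y(2,3)] x(4) y(4) by (simp add: u_def add.commute[of pi])
  also have "\<dots> \<le> norm (u x - u y)" using component_le_norm_cart[of "u x - u y" 2] by simp
  also have "\<dots> < 1" using dist_triangle2[of "u x" "u y" "v x\<^sub>0"] x(1) y(1) by (simp add: dist_norm)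
  finally show False by simp
qed

end

subsection \<open>The solution\<close>

lemma integrable_imp_locally_integrable_on:
  assumes "integrable (lebesgue_on \<Omega>) f" "\<Omega> \<in> sets lebesgue"
  shows "locally_integrable_on f \<Omega>"
  unfolding locally_integrable_on_def
proof (intro allI impI)
  fix C assume C: "compact C \<and> C \<subseteq> \<Omega>"
  have "set_integrable lebesgue \<Omega> f"
    using assms by (simp add: set_integrable_def integrable_restrict_space)
  then show "f absolutely_integrable_on C"
    by (rule set_integrable_subset) (use C in \<open>auto intro: fmeasurableD lmeasurable_compact\<close>)
qed

lemma borel_measurable_vector_2:
  fixes f g :: "'b \<Rightarrow> 'a::euclidean_space"
  assumes "f \<in> borel_measurable M" "g \<in> borel_measurable M"
  shows "(\<lambda>x. vector [f x, g x] :: 'a^2) \<in> borel_measurable M"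
proof (rule borel_measurable_continuous_Pair[OF assms])
  have "continuous_on UNIV (\<lambda>p::'a \<times> 'a. (\<chi> i. if i = 1 then fst p else snd p) :: 'a^2)"
  proof (rule continuous_on_vec_lambda)
    show "continuous_on UNIV (\<lambda>p::'a \<times> 'a. if i = 1 then fst p else snd p)" for i :: 2
      by (cases "i = 1") (simp_all add: continuous_on_fst continuous_on_snd)
  qed
  moreover have "(vector [a, b] :: 'a^2) = (\<chi> i. if i = 1 then a else b)" for a b
    by (simp add: vec_eq_iff forall_2)
  ultimately show "continuous_on UNIV (\<lambda>p::'a \<times> 'a. vector [fst p, snd p] :: 'a^2)" by simp
qed

text \<open>For empty \<open>K\<close> there is no pole to enumerate, and the zero map does.\<close>

lemma zero_solution:
  fixes \<Omega> :: "(real^2) set"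
  shows "(\<lambda>x. 0 :: real^2) \<in> W12 \<Omega> \<inter> Linfty \<Omega>" "weak_solution \<Omega> F_rhs (\<lambda>x. 0)"
    "open \<Omega> \<Longrightarrow> essentially_smooth_on \<Omega> (\<lambda>x. 0 :: real^2)"
proof -
  have z: "has_weak_jacobian \<Omega> (\<lambda>x. 0 :: real^2) (\<lambda>x. 0)"
    by (simp add: has_weak_jacobian_def has_weak_gradient_def locally_integrable_on_def)
  then show "(\<lambda>x. 0 :: real^2) \<in> W12 \<Omega> \<inter> Linfty \<Omega>"
    by (auto simp: W12_def Linfty_def L2_def intro!: exI[of _ "\<lambda>x. 0"])
  have "F_rhs 0 0 $ j = 0" for j
    using exhaust_2[of j] by (auto simp: F_rhs_def Let_def)
  then show "weak_solution \<Omega> F_rhs (\<lambda>x. 0)"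
    unfolding weak_solution_def using z by (intro exI[of _ "\<lambda>x. 0"]) simp
  assume "open \<Omega>"
  then have "smooth_on \<Omega> (\<lambda>x. 0 :: real^2)"
    by (rule smooth_on_coinduct[where X = "{\<lambda>x. 0}"]) (auto intro!: exI[of _ "\<lambda>x v. 0"])
  then show "essentially_smooth_on \<Omega> (\<lambda>x. 0 :: real^2)"
    by (auto simp: essentially_smooth_on_def)
qed

context log_potential
begin

definition Du :: "real^2 \<Rightarrow> real^2^2" where
  "Du x = vector [(cos (ln (w x)) / w x) *\<^sub>R Dw x, (- sin (ln (w x)) / w x) *\<^sub>R Dw x]"

lemma borel_measurable_u: "u \<in> borel_measurable borel"
  unfolding u_def[abs_def] by (intro borel_measurable_vector_2) measurable

lemma borel_measurable_Du: "Du \<in> borel_measurable borel"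
  unfolding Du_def[abs_def] by (intro borel_measurable_vector_2) measurable

lemma norm_u: "(u x $ 1)\<^sup>2 + (u x $ 2)\<^sup>2 = 1" "norm (u x) = 1"
proof -
  show *: "(u x $ 1)\<^sup>2 + (u x $ 2)\<^sup>2 = 1" by (simp add: u_def)
  then show "norm (u x) = 1" by (simp add: norm_vec_def L2_set_def sum_2)
qed

lemma norm_Du: "(norm (Du x $ 1))\<^sup>2 + (norm (Du x $ 2))\<^sup>2 = (norm (Dw x) / w x)\<^sup>2"
    "(norm (Du x))\<^sup>2 = (norm (Dw x) / w x)\<^sup>2"
proof -
  have "(norm (Du x $ 1))\<^sup>2 = (cos (ln (w x)))\<^sup>2 * (norm (Dw x) / w x)\<^sup>2"
    "(norm (Du x $ 2))\<^sup>2 = (sin (ln (w x)))\<^sup>2 * (norm (Dw x) / w x)\<^sup>2"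
    by (simp_all add: Du_def power_mult_distrib power_divide)
  then have "(norm (Du x $ 1))\<^sup>2 + (norm (Du x $ 2))\<^sup>2
      = ((cos (ln (w x)))\<^sup>2 + (sin (ln (w x)))\<^sup>2) * (norm (Dw x) / w x)\<^sup>2"
    by (simp only: distrib_right)
  then show *: "(norm (Du x $ 1))\<^sup>2 + (norm (Du x $ 2))\<^sup>2 = (norm (Dw x) / w x)\<^sup>2" by simp
  have "(norm (Du x))\<^sup>2 = (norm (Du x $ 1))\<^sup>2 + (norm (Du x $ 2))\<^sup>2"
    by (simp add: norm_vec_def[of "Du x"] L2_set_def sum_2)
  with * show "(norm (Du x))\<^sup>2 = (norm (Dw x) / w x)\<^sup>2" by simp
qed

text \<open>On the unit circle the denominator is 2 and cancels the factor 2. What remains is the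
  second derivative of \<open>sin (ln s)\<close> or \<open>cos (ln s)\<close> at
  \<open>s = w x\<close>, times \<open>(norm (Dw x))\<^sup>2\<close>, as in
  \<open>weak_identities\<close>.\<close>

lemma F_rhs_u:
  "F_rhs (u x) (Du x) $ 1 = (- sin (ln (w x)) - cos (ln (w x))) / (w x)\<^sup>2 * (norm (Dw x))\<^sup>2"
  "F_rhs (u x) (Du x) $ 2 = (sin (ln (w x)) - cos (ln (w x))) / (w x)\<^sup>2 * (norm (Dw x))\<^sup>2"
  unfolding F_rhs_def Let_def norm_u(1) norm_Du(1)
  by (simp_all add: u_def power_divide algebra_simps diff_divide_distrib add_divide_distrib)

lemma weak_identities_sin:
  assumes "\<phi> \<in> test_functions (ball 0 r)"
  shows "(LINT x|\<mu>. sin (ln (w x)) * gradient \<phi> x $ i) = - (LINT x|\<mu>. ((cos (ln (w x)) / w x) *\<^sub>R Dw x) $ i * \<phi> x)"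
    and "integrable \<mu> (\<lambda>x. (- sin (ln (w x)) - cos (ln (w x))) / (w x)\<^sup>2 * (norm (Dw x))\<^sup>2 * \<phi> x)"
    and "(LINT x|\<mu>. ((cos (ln (w x)) / w x) *\<^sub>R Dw x) \<bullet> gradient \<phi> x)
      = - (LINT x|\<mu>. (- sin (ln (w x)) - cos (ln (w x))) / (w x)\<^sup>2 * (norm (Dw x))\<^sup>2 * \<phi> x)"
proof -
  have "\<bar>- sin (ln s) - cos (ln s)\<bar> \<le> 2" for s :: real
    using abs_sin_le_one[of "ln s"] abs_cos_le_one[of "ln s"] by linarith
  then have b: "\<bar>(- sin (ln s) - cos (ln s)) / s\<^sup>2\<bar> \<le> 2 / s\<^sup>2" for s :: real
    by (simp add: abs_divide divide_right_mono)
  note * = weak_identities[OF assms, of "\<lambda>s. sin (ln s)" "\<lambda>s. cos (ln s) / s" "\<lambda>s. (- sin (ln s) - cos (ln s)) / s\<^sup>2"]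
  have d: "((\<lambda>s. sin (ln s)) has_real_derivative cos (ln s) / s) (at s)"
    "((\<lambda>s. cos (ln s) / s) has_real_derivative (- sin (ln s) - cos (ln s)) / s\<^sup>2) (at s)" if "0 < s" for s :: real
    using that by (auto intro!: derivative_eq_intros simp: field_simps power2_eq_square)
  have c: "continuous_on {0<..} (\<lambda>s::real. (- sin (ln s) - cos (ln s)) / s\<^sup>2)"
    by (intro continuous_intros) auto
  show "(LINT x|\<mu>. sin (ln (w x)) * gradient \<phi> x $ i) = - (LINT x|\<mu>. ((cos (ln (w x)) / w x) *\<^sub>R Dw x) $ i * \<phi> x)"
    by (rule *(1)) (use d c b in \<open>auto simp: abs_divide divide_right_mono\<close>)
  show "integrable \<mu> (\<lambda>x. (- sin (ln (w x)) - cos (ln (w x))) / (w x)\<^sup>2 * (norm (Dw x))\<^sup>2 * \<phi> x)"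
    by (rule *(2)) (use d c b in \<open>auto simp: abs_divide divide_right_mono\<close>)
  show "(LINT x|\<mu>. ((cos (ln (w x)) / w x) *\<^sub>R Dw x) \<bullet> gradient \<phi> x)
      = - (LINT x|\<mu>. (- sin (ln (w x)) - cos (ln (w x))) / (w x)\<^sup>2 * (norm (Dw x))\<^sup>2 * \<phi> x)"
    by (rule *(3)) (use d c b in \<open>auto simp: abs_divide divide_right_mono\<close>)
qed

lemma weak_identities_cos:
  assumes "\<phi> \<in> test_functions (ball 0 r)"
  shows "(LINT x|\<mu>. cos (ln (w x)) * gradient \<phi> x $ i) = - (LINT x|\<mu>. ((- sin (ln (w x)) / w x) *\<^sub>R Dw x) $ i * \<phi> x)"
    and "integrable \<mu> (\<lambda>x. (sin (ln (w x)) - cos (ln (w x))) / (w x)\<^sup>2 * (norm (Dw x))\<^sup>2 * \<phi> x)"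
    and "(LINT x|\<mu>. ((- sin (ln (w x)) / w x) *\<^sub>R Dw x) \<bullet> gradient \<phi> x)
      = - (LINT x|\<mu>. (sin (ln (w x)) - cos (ln (w x))) / (w x)\<^sup>2 * (norm (Dw x))\<^sup>2 * \<phi> x)"
proof -
  have "\<bar>sin (ln s) - cos (ln s)\<bar> \<le> 2" for s :: real
    using abs_sin_le_one[of "ln s"] abs_cos_le_one[of "ln s"] by linarith
  then have b: "\<bar>(sin (ln s) - cos (ln s)) / s\<^sup>2\<bar> \<le> 2 / s\<^sup>2" for s :: real
    by (simp add: abs_divide divide_right_mono)
  note * = weak_identities[OF assms, of "\<lambda>s. cos (ln s)" "\<lambda>s. - sin (ln s) / s" "\<lambda>s. (sin (ln s) - cos (ln s)) / s\<^sup>2"]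
  have d: "((\<lambda>s. cos (ln s)) has_real_derivative - sin (ln s) / s) (at s)"
    "((\<lambda>s. - sin (ln s) / s) has_real_derivative (sin (ln s) - cos (ln s)) / s\<^sup>2) (at s)" if "0 < s" for s :: real
    using that by (auto intro!: derivative_eq_intros simp: field_simps power2_eq_square)
  have c: "continuous_on {0<..} (\<lambda>s::real. (sin (ln s) - cos (ln s)) / s\<^sup>2)"
    by (intro continuous_intros) auto
  show "(LINT x|\<mu>. cos (ln (w x)) * gradient \<phi> x $ i) = - (LINT x|\<mu>. ((- sin (ln (w x)) / w x) *\<^sub>R Dw x) $ i * \<phi> x)"
    by (rule *(1)) (use d c b in \<open>auto simp: abs_divide divide_right_mono\<close>)
  show "integrable \<mu> (\<lambda>x. (sin (ln (w x)) - cos (ln (w x))) / (w x)\<^sup>2 * (norm (Dw x))\<^sup>2 * \<phi> x)"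
    by (rule *(2)) (use d c b in \<open>auto simp: abs_divide divide_right_mono\<close>)
  show "(LINT x|\<mu>. ((- sin (ln (w x)) / w x) *\<^sub>R Dw x) \<bullet> gradient \<phi> x)
      = - (LINT x|\<mu>. (sin (ln (w x)) - cos (ln (w x))) / (w x)\<^sup>2 * (norm (Dw x))\<^sup>2 * \<phi> x)"
    by (rule *(3)) (use d c b in \<open>auto simp: abs_divide divide_right_mono\<close>)
qed

lemma integrable_norm_Du: "integrable \<mu> (\<lambda>x. (norm (Du x))\<^sup>2)" "integrable \<mu> Du"
proof -
  have G: "AE x in \<mu>. (norm (Du x))\<^sup>2 \<le> \<kappa> * G x \<and> norm (Du x) \<le> 1 + \<kappa> * G x"
    using AE_good
  proof eventually_elim
    case (elim x)
    have "0 < w x" using good_bounds(2)[OF elim] wmin_pos by linarith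
    then have "norm (Du x) = norm (Dw x) / w x"
      by (intro power2_eq_imp_eq[OF norm_Du(2)]) simp_all
    then show ?case using good_ratio_bounds(3,4)[OF elim] by (simp only: simp_thms)
  qed
  have m: "(\<lambda>x. (norm (Du x))\<^sup>2) \<in> borel_measurable \<mu>" "Du \<in> borel_measurable \<mu>"
    using borel_measurable_Du by (intro measurable_\<mu>; measurable)+
  show "integrable \<mu> (\<lambda>x. (norm (Du x))\<^sup>2)"
    by (rule Bochner_Integration.integrable_bound[OF integrable_\<mu>_G[of 1 0 \<kappa>] m(1)], rule eventually_mono[OF G]) (simp, linarith)
  show "integrable \<mu> Du"
    by (rule Bochner_Integration.integrable_bound[OF integrable_\<mu>_G[of 1 1 \<kappa>] m(2)], rule eventually_mono[OF G]) (simp, linarith)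
qed

lemma integrable_u: "integrable \<mu> u"
  using norm_u(2) by (intro integrable_lebesgue_on_ball_bounded[where C = 1] borel_measurable_u) simp

lemma u_has_weak_jacobian: "has_weak_jacobian (ball 0 r) u Du"
proof -
  have B: "ball (0 :: real^2) r \<in> sets lebesgue" by simp
  have comp: "integrable \<mu> (\<lambda>x. f x $ j)" if "integrable \<mu> f" for f :: "real^2 \<Rightarrow> 'b::euclidean_space^2" and j
    by (rule integrable_bounded_linear[OF bounded_linear_vec_nth that])
  note loc = integrable_imp_locally_integrable_on[OF comp[OF integrable_u] B]
    integrable_imp_locally_integrable_on[OF comp[OF integrable_norm_Du(2)] B]
  have u: "u x $ 1 = sin (ln (w x))" "u x $ 2 = cos (ln (w x))"
    "Du x $ 1 = (cos (ln (w x)) / w x) *\<^sub>R Dw x" "Du x $ 2 = (- sin (ln (w x)) / w x) *\<^sub>R Dw x" for x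
    by (simp_all add: u_def Du_def)
  have "has_weak_gradient (ball 0 r) (\<lambda>x. u x $ 1) (\<lambda>x. Du x $ 1)"
    unfolding has_weak_gradient_def
  proof (intro conjI loc ballI allI)
    fix \<phi> :: "real^2 \<Rightarrow> real" and i :: 2 assume "\<phi> \<in> test_functions (ball 0 r)"
    then show "(LINT x|\<mu>. u x $ 1 * gradient \<phi> x $ i) = - (LINT x|\<mu>. Du x $ 1 $ i * \<phi> x)"
      unfolding u by (rule weak_identities_sin)
  qed
  moreover have "has_weak_gradient (ball 0 r) (\<lambda>x. u x $ 2) (\<lambda>x. Du x $ 2)"
    unfolding has_weak_gradient_def
  proof (intro conjI loc ballI allI)
    fix \<phi> :: "real^2 \<Rightarrow> real" and i :: 2 assume "\<phi> \<in> test_functions (ball 0 r)"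
    then show "(LINT x|\<mu>. u x $ 2 * gradient \<phi> x $ i) = - (LINT x|\<mu>. Du x $ 2 $ i * \<phi> x)"
      unfolding u by (rule weak_identities_cos)
  qed
  ultimately show ?thesis unfolding has_weak_jacobian_def by (simp add: forall_2)
qed

lemma u_in_W12_Linfty: "u \<in> W12 (ball 0 r) \<inter> Linfty (ball 0 r)"
proof -
  have "u \<in> borel_measurable \<mu>" "Du \<in> borel_measurable \<mu>"
    using borel_measurable_u borel_measurable_Du by (auto intro!: measurable_\<mu>)
  moreover have "integrable \<mu> (\<lambda>x. (norm (u x))\<^sup>2)"
    by (rule integrable_lebesgue_on_ball_bounded[where C = 1]) (simp_all add: norm_u(2))
  moreover have "AE x in \<mu>. norm (u x) \<le> 1" by (simp add: norm_u(2))
  ultimately show ?thesis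
    unfolding W12_def Linfty_def L2_def using u_has_weak_jacobian integrable_norm_Du(1) by blast
qed

lemma u_weak_solution: "weak_solution (ball 0 r) F_rhs u"
proof -
  have "integrable \<mu> (\<lambda>x. F_rhs (u x) (Du x) $ j * \<phi> x) \<and>
    - (LINT x|\<mu>. (Du x $ j) \<bullet> gradient \<phi> x) = (LINT x|\<mu>. F_rhs (u x) (Du x) $ j * \<phi> x)"
    if "\<phi> \<in> test_functions (ball 0 r)" for j \<phi>
  proof -
    have "j = 1 \<or> j = 2" by (rule exhaust_2)
    then show ?thesis
    proof
      assume "j = 1"
      then show ?thesis
        using weak_identities_sin(2,3)[OF that] unfolding F_rhs_u \<open>j = 1\<close> by (simp add: Du_def)
    next
      assume "j = 2"
      then show ?thesis
        using weak_identities_cos(2,3)[OF that] unfolding F_rhs_u \<open>j = 2\<close> by (simp add: Du_def)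
    qed
  qed
  with u_has_weak_jacobian show ?thesis unfolding weak_solution_def by blast
qed

end

theorem theorem1p1:
  fixes r :: real and K :: "(real^2) set"
  assumes "0 < r" and "r < 1 / exp 1"
    and "compact K" and "K \<subseteq> ball 0 r"
  shows "\<exists>u :: real^2 \<Rightarrow> real^2.
           u \<in> W12 (ball 0 r) \<inter> Linfty (ball 0 r) \<and>
           weak_solution (ball 0 r) F_rhs u \<and>
           (\<forall>x\<^sub>0\<in>K. essentially_discontinuous_at (ball 0 r) u x\<^sub>0) \<and>
           essentially_smooth_on (ball 0 r - K) u"
proof (cases "K = {}")
  case True
  then show ?thesis using zero_solution[of "ball 0 r"] by auto
next
  case False
  obtain T where T: "countable T" "T \<subseteq> K" "K \<subseteq> closure T"
    using separable[of K] by blast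
  with False have "T \<noteq> {}" by auto
  \<comment> \<open>For finite \<open>T\<close> this enumeration repeats its elements.\<close>
  define z where "z = from_nat_into T"
  have range_z: "range z = T" unfolding z_def using T(1) \<open>T \<noteq> {}\<close> by (rule range_from_nat_into[rotated])
  have closure_z: "closure (range z) = K"
    unfolding range_z using T(2,3) closure_minimal[OF T(2) compact_imp_closed[OF assms(3)]] by blast
  obtain c :: "nat \<Rightarrow> real" where c: "\<And>j. 0 < c j" "\<And>j. c j \<le> (1/4) ^ j"
    and sep: "\<And>j k. k < j \<Longrightarrow> z k \<noteq> z j \<Longrightarrow> exp (- ((1/2) ^ j) / c j) \<le> (1/2) ^ (j + 3) * norm (z j - z k)"
    using exists_small_coefficients[of z] by blast
  interpret log_potential r c z
  proof
    have "1 / exp 1 \<le> 1 / (2::real)" using exp_ge_add_one_self[of 1] by (intro divide_left_mono) auto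
    with assms(2) show "2 * r < 1" by linarith
    show "c k \<le> 1" for k using c(2)[of k] power_le_one[of "1/4::real" k] by simp
    show "z k \<in> ball 0 r" for k using range_z T(2) assms(4) by blast
    \<comment> \<open>The factor \<open>(1/4) ^ k\<close> in the choice of the coefficients makes
      their square roots geometric.\<close>
    have "sqrt (c k) \<le> (1/2) ^ k" for k
    proof -
      have "(1/4 :: real) ^ k = ((1/2) ^ k)\<^sup>2" by (simp add: power2_eq_square flip: power_mult_distrib)
      then show ?thesis using c(2)[of k] by (intro real_le_lsqrt) auto
    qed
    then show "summable (\<lambda>k. sqrt (c k))"
      by (intro summable_comparison_test'[OF summable_geometric[of "1/2::real"], of 0])
         (simp_all add: less_imp_le[OF c(1)])
  qed (use assms c in auto)
  show ?thesis
  proof (intro exI[of _ u] conjI ballI)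
    show "essentially_discontinuous_at (ball 0 r) u x\<^sub>0" if "x\<^sub>0 \<in> K" for x\<^sub>0
      using essentially_discontinuous_at_pole_closure[OF sep] that closure_z by blast
    show "essentially_smooth_on (ball 0 r - K) u"
      using smooth_on_u unfolding essentially_smooth_on_def closure_z by auto
  qed (use u_in_W12_Linfty u_weak_solution in auto)
qed

end
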